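(* Let $X$ be a minimal sequence over a finite alphabet. Then $X$ is substitutive primitive if and only if the set $\{\mathcal{D}_u(X) : u \text{ a non-empty prefix of } X\}$ of its derived sequences is finite.
   Context: An alphabet is a finite set of letters. Words are finite; $|w|$ is the length of $w$, $\mathcal{A}^+$ the set of non-empty words over $\mathcal{A}$. A sequence on $\mathcal{A}$ is an element $X=X_0X_1X_2\cdots$ of $\mathcal{A}^{\mathbb{N}}$; its factors are the words $X_{[k,l]}=X_kX_{k+1}\cdots X_l$ ($k\le l$) together with the empty word, and $L(X)$ is the set of factors. An occurrence of a word $u$ in $X$ is an integer $i\ge 0$ with $X_{[i,i+|u|-1]}=u$. A map $\mathcal{A}\to\mathcal{B}^+$ is extended by concatenation to words and sequences. Minimal sequence: $X$ is minimal (uniformly recurrent) if for every integer $l$ there is an integer $k$ such that every factor of $X$ of length $l$ occurs in every factor of $X$ of length $k$. Substitutions: a substitution is a triple $(\zeta,\mathcal{A},\alpha)$ where $\mathcal{A}$ is an alphabet, $\zeta:\mathcal{A}\to\mathcal{A}^+$ a map and $\alpha\in\mathcal{A}$ a letter such that the first letter of $\zeta(\alpha)$ is $\alpha$ and $|\zeta^n(\alpha)|\to+\infty$ as $n\to+\infty$. Its fixed point is the sequence $X_\zeta=\lim_{n\to\infty}\zeta^n(\alpha)$, characterized by $\zeta(X_\zeta)=X_\zeta$ and having first letter $\alpha$. The substitution is primitive if there is an integer $k$ such that for all $\beta,\gamma\in\mathcal{A}$, $\gamma$ is a factor of $\zeta^k(\beta)$. A sequence $Y$ over $\mathcal{A}$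 is substitutive primitive if there are a primitive substitution $(\zeta,\mathcal{B},\alpha)$ and a letter-to-letter map $\varphi:\mathcal{B}\to\mathcal{A}$ with $\varphi(X_\zeta)=Y$. Return words and derived sequences: let $X$ be minimal and $u$ a non-empty prefix of $X$. A return word over $u$ is a word $X_{[i,j-1]}$ where $i<j$ are two successive occurrences of $u$ in $X$; $\mathcal{H}_{X,u}$ is the (finite) set of return words over $u$. Cutting $X$ at all occurrences of $u$ writes $X$ uniquely as a concatenation $X=m_0m_1m_2\cdots$ of elements of $\mathcal{H}_{X,u}$. Order $\mathcal{H}_{X,u}$ by rank of first appearance in $(m_n)_{n\ge 0}$; this gives a bijection $\Lambda_{X,u}:\mathcal{H}_{X,u}\to\mathcal{N}_{X,u}=\{1,\dots,\mathrm{Card}(\mathcal{H}_{X,u})\}$. The derived sequence of $X$ with respect to $u$ is $\mathcal{D}_u(X)=\Lambda_{X,u}(m_0)\Lambda_{X,u}(m_1)\Lambda_{X,u}(m_2)\cdots\in\mathcal{N}_{X,u}^{\mathbb{N}}$. *)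

theory Defs
  imports Complex_Main "HOL-Library.Sublist" "HOL-Library.Omega_Words_Fun"
begin

text \<open>
  Finite words are lists and sequences are functions on \<^typ>\<open>nat\<close>. Alphabets are finite sets of
  letters. The notation \<open>X [i \<rightarrow> j]\<close> excludes the right end point: it is
  \<open>X\<^sub>i X\<^sub>i\<^sub>+\<^sub>1 \<dots> X\<^sub>j\<^sub>-\<^sub>1\<close>, and the empty word if \<open>j \<le> i\<close>.
\<close>

definition factors :: "(nat \<Rightarrow> 'a) \<Rightarrow> 'a list set" where
  "factors X = {X [i \<rightarrow> j] | i j. True}"

definition minimal_sequence :: "(nat \<Rightarrow> 'a) \<Rightarrow> bool" where
  "minimal_sequence X \<longleftrightarrow>
     (\<forall>l. \<exists>k. \<forall>u \<in> factors X. \<forall>v \<in> factors X.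
        length u = l \<longrightarrow> length v = k \<longrightarrow> sublist u v)"


subsection \<open>Substitutions\<close>

definition extend_word :: "('a \<Rightarrow> 'b list) \<Rightarrow> 'a list \<Rightarrow> 'b list" where
  "extend_word \<zeta> w = concat (map \<zeta> w)"

definition iterate :: "('b \<Rightarrow> 'b list) \<Rightarrow> nat \<Rightarrow> 'b \<Rightarrow> 'b list" where
  "iterate \<zeta> n \<beta> = (extend_word \<zeta> ^^ n) [\<beta>]"

definition substitution :: "('b \<Rightarrow> 'b list) \<Rightarrow> 'b set \<Rightarrow> 'b \<Rightarrow> bool" where
  "substitution \<zeta> B \<alpha> \<longleftrightarrow>
     finite B \<and> \<alpha> \<in> B \<and> (\<forall>\<beta> \<in> B. \<zeta> \<beta> \<noteq> [] \<and> set (\<zeta> \<beta>) \<subseteq> B) \<and>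
     hd (\<zeta> \<alpha>) = \<alpha> \<and> filterlim (\<lambda>n. length (iterate \<zeta> n \<alpha>)) at_top sequentially"

text \<open>
  The limit of the words \<open>\<zeta>\<^sup>n(\<alpha>)\<close>: the letter in position \<open>i\<close> is the one that these words
  eventually have there. See \<open>iterate_eq_fixed_point_prefix\<close> and \<open>fixed_point_fixed\<close> below.
\<close>

definition fixed_point :: "('b \<Rightarrow> 'b list) \<Rightarrow> 'b \<Rightarrow> nat \<Rightarrow> 'b" where
  "fixed_point \<zeta> \<alpha> i =
     (THE \<beta>. \<forall>\<^sub>F n in sequentially. i < length (iterate \<zeta> n \<alpha>) \<and> iterate \<zeta> n \<alpha> ! i = \<beta>)"

definition primitive_substitution :: "('b \<Rightarrow> 'b list) \<Rightarrow> 'b set \<Rightarrow> 'b \<Rightarrow> bool" where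
  "primitive_substitution \<zeta> B \<alpha> \<longleftrightarrow>
     substitution \<zeta> B \<alpha> \<and> (\<exists>k. \<forall>\<beta> \<in> B. \<forall>\<gamma> \<in> B. \<gamma> \<in> set (iterate \<zeta> k \<beta>))"

text \<open>
  HOL has no quantification over types in formulas, so the letters of the auxiliary alphabet \<open>B\<close>
  are natural numbers. As \<open>B\<close> is finite this is only a choice of names for its letters:
  \<open>substitutive_primitiveI\<close> below allows letters of an arbitrary type.
\<close>

definition substitutive_primitive :: "'a set \<Rightarrow> (nat \<Rightarrow> 'a) \<Rightarrow> bool" where
  "substitutive_primitive A Y \<longleftrightarrow>
     (\<exists>(\<zeta> :: nat \<Rightarrow> nat list) B \<alpha> \<phi>.
        primitive_substitution \<zeta> B \<alpha> \<and> \<phi> ` B \<subseteq> A \<and> \<phi> \<circ> fixed_point \<zeta> \<alpha> = Y)"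


subsection \<open>Return words and derived sequences\<close>

definition occurrences :: "(nat \<Rightarrow> 'a) \<Rightarrow> 'a list \<Rightarrow> nat set" where
  "occurrences X u = {i. X [i \<rightarrow> i + length u] = u}"

definition return_words :: "(nat \<Rightarrow> 'a) \<Rightarrow> 'a list \<Rightarrow> 'a list set" where
  "return_words X u =
     {X [i \<rightarrow> j] | i j. i < j \<and> i \<in> occurrences X u \<and> j \<in> occurrences X u \<and>
        (\<forall>l. i < l \<and> l < j \<longrightarrow> l \<notin> occurrences X u)}"

text \<open>
  The word \<open>m\<^sub>n\<close> of the decomposition of \<open>X\<close> into return words over \<open>u\<close>. The occurrences are
  listed in increasing order; for a non-empty prefix \<open>u\<close> of a minimal sequence there are infinitely
  many of them, and the first one is \<open>0\<close>.
\<close>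

definition return_factor :: "(nat \<Rightarrow> 'a) \<Rightarrow> 'a list \<Rightarrow> nat \<Rightarrow> 'a list" where
  "return_factor X u n =
     X [enumerate (occurrences X u) n \<rightarrow> enumerate (occurrences X u) (Suc n)]"

definition first_appearance :: "(nat \<Rightarrow> 'a) \<Rightarrow> 'a list \<Rightarrow> 'a list \<Rightarrow> nat" where
  "first_appearance X u w = (LEAST n. return_factor X u n = w)"

text \<open>
  The bijection \<open>\<Lambda>\<close> onto \<open>{1..card (return_words X u)}\<close>: the rank, starting from \<open>1\<close>, of a return
  word in the order of first appearance.
\<close>

definition return_index :: "(nat \<Rightarrow> 'a) \<Rightarrow> 'a list \<Rightarrow> 'a list \<Rightarrow> nat" where
  "return_index X u w =
     card {v \<in> return_words X u. first_appearance X u v \<le> first_appearance X u w}"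

definition derived_sequence :: "(nat \<Rightarrow> 'a) \<Rightarrow> 'a list \<Rightarrow> nat \<Rightarrow> nat" where
  "derived_sequence X u n = return_index X u (return_factor X u n)"

definition nonempty_prefixes :: "(nat \<Rightarrow> 'a) \<Rightarrow> 'a list set" where
  "nonempty_prefixes X = {u. u \<noteq> [] \<and> (\<exists>n. u = X [0 \<rightarrow> n])}"


subsection \<open>The fixed point and the choice of letters\<close>

lemma iterate_0: "iterate \<zeta> 0 \<beta> = [\<beta>]"
  by (simp add: iterate_def)

lemma iterate_Suc: "iterate \<zeta> (Suc n) \<beta> = extend_word \<zeta> (iterate \<zeta> n \<beta>)"
  by (simp add: iterate_def)

lemma extend_word_append: "extend_word \<zeta> (u @ v) = extend_word \<zeta> u @ extend_word \<zeta> v"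
  by (simp add: extend_word_def)

lemma iterate_prefix_Suc:
  assumes "substitution \<zeta> B \<alpha>"
  shows "\<exists>w. iterate \<zeta> (Suc n) \<alpha> = iterate \<zeta> n \<alpha> @ w"
proof (induction n)
  case 0
  from assms have "\<zeta> \<alpha> = \<alpha> # tl (\<zeta> \<alpha>)"
    unfolding substitution_def by (metis list.collapse)
  then show ?case by (auto simp: iterate_0 iterate_Suc extend_word_def)
next
  case (Suc n)
  then show ?case by (metis iterate_Suc extend_word_append)
qed

lemma iterate_prefix:
  assumes "substitution \<zeta> B \<alpha>" "m \<le> n"
  shows "\<exists>w. iterate \<zeta> n \<alpha> = iterate \<zeta> m \<alpha> @ w"
  using assms(2)
proof (induction n rule: dec_induct)
  case (step n)
  then show ?case by (metis iterate_prefix_Suc[OF assms(1)] append.assoc)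
qed simp

lemma fixed_point_nth:
  assumes s: "substitution \<zeta> B \<alpha>" and i: "i < length (iterate \<zeta> n \<alpha>)"
  shows "fixed_point \<zeta> \<alpha> i = iterate \<zeta> n \<alpha> ! i"
proof -
  let ?P = "\<lambda>\<beta> m. i < length (iterate \<zeta> m \<alpha>) \<and> iterate \<zeta> m \<alpha> ! i = \<beta>"
  have "?P (iterate \<zeta> n \<alpha> ! i) m" if "n \<le> m" for m
    using iterate_prefix[OF s that] i by (auto simp: nth_append)
  then have ev: "\<forall>\<^sub>F m in sequentially. ?P (iterate \<zeta> n \<alpha> ! i) m"
    unfolding eventually_sequentially by blast
  show ?thesis unfolding fixed_point_def
  proof (rule the_equality)
    show "\<forall>\<^sub>F m in sequentially. ?P (iterate \<zeta> n \<alpha> ! i) m" by (rule ev)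
  next
    fix \<beta> assume "\<forall>\<^sub>F m in sequentially. ?P \<beta> m"
    from eventually_conj[OF this ev] have "\<exists>m. ?P \<beta> m \<and> ?P (iterate \<zeta> n \<alpha> ! i) m"
      unfolding eventually_sequentially by auto
    then show "\<beta> = iterate \<zeta> n \<alpha> ! i" by auto
  qed
qed

lemma iterate_eq_fixed_point_prefix:
  assumes "substitution \<zeta> B \<alpha>"
  shows "iterate \<zeta> n \<alpha> = fixed_point \<zeta> \<alpha> [0 \<rightarrow> length (iterate \<zeta> n \<alpha>)]"
  by (rule nth_equalityI) (simp_all add: fixed_point_nth[OF assms])

lemma long_iterate:
  assumes "substitution \<zeta> B \<alpha>"
  shows "\<exists>n. k \<le> length (iterate \<zeta> n \<alpha>)"
  using assms unfolding substitution_def filterlim_at_top eventually_sequentially by blast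

text \<open>
  \<open>\<zeta>(X) = X\<close>, where \<open>\<zeta>(X)\<close> is the sequence with the prefixes \<open>\<zeta>(X\<^sub>0 \<dots> X\<^sub>k\<^sub>-\<^sub>1)\<close>, and \<open>X\<close> has
  first letter \<open>\<alpha>\<close>.
\<close>

lemma fixed_point_fixed:
  fixes \<zeta> \<alpha>
  defines "X \<equiv> fixed_point \<zeta> \<alpha>"
  assumes s: "substitution \<zeta> B \<alpha>"
  shows "X 0 = \<alpha>"
    and "extend_word \<zeta> (X [0 \<rightarrow> k]) = X [0 \<rightarrow> length (extend_word \<zeta> (X [0 \<rightarrow> k]))]"
proof -
  show "X 0 = \<alpha>"
    using fixed_point_nth[OF s, of 0 0] by (simp add: X_def iterate_0)
  obtain n where n: "k \<le> length (iterate \<zeta> n \<alpha>)" using long_iterate[OF s] by blast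
  let ?w = "iterate \<zeta> n \<alpha>"
  have take_k: "take k ?w = X [0 \<rightarrow> k]"
    using arg_cong[OF iterate_eq_fixed_point_prefix[OF s, of n], of "take k"] n
    by (simp add: X_def min_def)
  have "iterate \<zeta> (Suc n) \<alpha> = extend_word \<zeta> (take k ?w) @ extend_word \<zeta> (drop k ?w)"
    by (metis iterate_Suc extend_word_append append_take_drop_id)
  then have e: "X [0 \<rightarrow> length (iterate \<zeta> (Suc n) \<alpha>)]
      = extend_word \<zeta> (X [0 \<rightarrow> k]) @ extend_word \<zeta> (drop k ?w)"
    using iterate_eq_fixed_point_prefix[OF s, of "Suc n"] take_k by (simp add: X_def)
  let ?l = "length (extend_word \<zeta> (X [0 \<rightarrow> k]))"
  from arg_cong[OF e, of length] have "?l \<le> length (iterate \<zeta> (Suc n) \<alpha>)" by simp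
  then show "extend_word \<zeta> (X [0 \<rightarrow> k]) = X [0 \<rightarrow> ?l]"
    using arg_cong[OF e, of "take ?l"] by (simp add: min_def)
qed

lemma set_iterate:
  assumes "substitution \<zeta> B \<alpha>" "\<beta> \<in> B"
  shows "set (iterate \<zeta> n \<beta>) \<subseteq> B"
proof (induction n)
  case 0
  then show ?case using assms(2) by (simp add: iterate_0)
next
  case (Suc n)
  then show ?case using assms(1)
    unfolding substitution_def iterate_Suc extend_word_def by fastforce
qed

lemma substitutive_primitiveI:
  fixes \<zeta> :: "'b \<Rightarrow> 'b list"
  assumes p: "primitive_substitution \<zeta> B \<alpha>" and \<phi>: "\<phi> ` B \<subseteq> A"
    and Y: "\<phi> \<circ> fixed_point \<zeta> \<alpha> = Y"
  shows "substitutive_primitive A Y"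
proof -
  from p have s: "substitution \<zeta> B \<alpha>" unfolding primitive_substitution_def by blast
  then have fin: "finite B" and \<alpha>: "\<alpha> \<in> B" unfolding substitution_def by blast+
  obtain e :: "'b \<Rightarrow> nat" where e: "inj_on e B"
    using finite_imp_inj_to_nat_seg[OF fin] by blast
  define g where "g = the_inv_into B e"
  have ge: "g (e \<beta>) = \<beta>" if "\<beta> \<in> B" for \<beta>
    using that e unfolding g_def by (simp add: the_inv_into_f_f)
  define \<xi> where "\<xi> x = map e (\<zeta> (g x))" for x
  have ext: "extend_word \<xi> (map e w) = map e (extend_word \<zeta> w)" if "set w \<subseteq> B" for w
    using that by (induction w) (simp_all add: extend_word_def \<xi>_def ge)
  have it: "iterate \<xi> n (e \<beta>) = map e (iterate \<zeta> n \<beta>)" if "\<beta> \<in> B" for n \<beta>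
  proof (induction n)
    case (Suc n)
    then show ?case using ext[OF set_iterate[OF s that]] by (simp add: iterate_Suc)
  qed (simp add: iterate_0)
  have s': "substitution \<xi> (e ` B) (e \<alpha>)"
    using s by (auto simp: substitution_def \<xi>_def ge it hd_map)
  have p': "primitive_substitution \<xi> (e ` B) (e \<alpha>)"
    using p s' by (auto simp: primitive_substitution_def it)
  have "(\<phi> \<circ> g) (fixed_point \<xi> (e \<alpha>) i) = \<phi> (fixed_point \<zeta> \<alpha> i)" for i
  proof -
    obtain n where n: "i < length (iterate \<zeta> n \<alpha>)"
      using long_iterate[OF s, of "Suc i"] by (auto simp: Suc_le_eq)
    have B: "iterate \<zeta> n \<alpha> ! i \<in> B" using set_iterate[OF s \<alpha>, of n] nth_mem[OF n] by blast
    show ?thesis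
      using fixed_point_nth[OF s n] fixed_point_nth[OF s', of i n] n B by (simp add: it[OF \<alpha>] ge)
  qed
  then have Y': "(\<phi> \<circ> g) \<circ> fixed_point \<xi> (e \<alpha>) = Y" using Y by (auto simp: fun_eq_iff)
  have "(\<phi> \<circ> g) ` e ` B \<subseteq> A" using \<phi> by (auto simp: ge)
  then show ?thesis unfolding substitutive_primitive_def using p' Y' by blast
qed

end

theory Submission
  imports Defs
begin

text \<open>
  Suppose \<open>u\<close> and a much longer prefix \<open>v\<close> have the same derived sequence \<open>D\<close>. Cutting the return words
  over \<open>v\<close> into return words over \<open>u\<close> gives a substitution that fixes \<open>D\<close>. Spreading its images over the
  pairs (letter of \<open>D\<close>, offset in the return word over \<open>u\<close>) makes the coding letter-to-letter. If \<open>X\<close> is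
  not periodic, the return words over \<open>v\<close> are as long as we like, which makes the substitution primitive.

  Conversely, let \<open>X = \<phi>(Y)\<close> with \<open>Y\<close> fixed by a primitive \<open>\<zeta>\<close>, and let \<open>u\<close> be a prefix of \<open>X\<close>. For a
  suitable \<open>m\<close> all the words \<open>\<phi>(\<zeta>\<^sup>m(\<beta>))\<close> contain \<open>u\<close> and have length at most a constant times \<open>|u|\<close>. The
  return words over \<open>u\<close> that start in such a block are then determined by two consecutive letters
  of \<open>Y\<close>, and their number is bounded independently of \<open>u\<close> unless \<open>X\<close> is periodic. So the derived
  sequence is determined by a coding of pairs of letters for which only finitely many choices exist.
\<close>

subsection \<open>Words and counting\<close>

lemma subsequence_eq_iff:
  "X [i \<rightarrow> i + n] = Y [j \<rightarrow> j + m] \<longleftrightarrow> n = m \<and> (\<forall>s<n. X (i + s) = Y (j + s))"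
  by (auto simp: list_eq_iff_nth_eq)

lemma subsequence_eqD:
  assumes "X [i \<rightarrow> j] = X [i' \<rightarrow> j']" "i \<le> j" "i' \<le> j'"
  shows "j - i = j' - i'" and "s < j - i \<Longrightarrow> X (i + s) = X (i' + s)"
  using assms subsequence_eq_iff[of X i "j - i" X i' "j' - i'"] by auto

lemma subsequence_eqI:
  assumes "i \<le> j" "i' \<le> j'" "j - i = j' - i'" "\<And>s. s < j - i \<Longrightarrow> X (i + s) = Y (i' + s)"
  shows "X [i \<rightarrow> j] = Y [i' \<rightarrow> j']"
  using assms by (simp add: list_eq_iff_nth_eq)

lemma subsequence_split:
  assumes "i \<le> j" "j \<le> k"
  shows "X [i \<rightarrow> k] = X [i \<rightarrow> j] @ X [j \<rightarrow> k]"
  using upt_add_eq_append[OF assms(1), of "k - j"] assms by (simp add: subsequence_def)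

text \<open>Pure periodicity, without a preperiod. Both directions of the characterization treat it
  separately, since the occurrences of long prefixes are forced far apart only in its
  absence.\<close>

definition periodic :: "(nat \<Rightarrow> 'a) \<Rightarrow> bool" where
  "periodic X \<longleftrightarrow> (\<exists>d>0. \<forall>i. X (i + d) = X i)"

lemma mod_period:
  fixes X :: "nat \<Rightarrow> 'a"
  assumes "\<And>i. X (i + d) = X i"
  shows "X (i mod d) = X i"
proof -
  have "X (j + k * d) = X j" for j k
    by (induction k) (simp_all add: assms flip: add.assoc, metis add.assoc add.commute assms)
  from this[of "i mod d" "i div d"] show ?thesis by simp
qed

text \<open>A finite set of positions represents all values, and \<open>N\<close> bounds these
  positions.\<close>

lemma finite_range_bounded:
  fixes P :: "nat \<Rightarrow> 'a"
  assumes "finite (range P)"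
  obtains N where "\<And>n. \<exists>m<N. P m = P n"
proof -
  obtain C where C: "finite C" "range P = P ` C"
    using finite_subset_image[OF assms, of P UNIV] by auto
  then obtain N where "C \<subseteq> {..<N}" using finite_nat_iff_bounded by blast
  moreover have "P n \<in> P ` C" for n using C(2) rangeI[of P n] by simp
  ultimately have "\<exists>m<N. P m = P n" for n
    by (metis imageE lessThan_iff subsetD)
  then show ?thesis using that by blast
qed

text \<open>The first block whose right end exceeds \<open>t\<close> contains \<open>t\<close>,
  because the block before it, if any, ends at or before \<open>t\<close>.\<close>

lemma strict_mono_block:
  fixes L :: "nat \<Rightarrow> nat"
  assumes "strict_mono L" "L 0 = 0"
  shows "\<exists>n. L n \<le> t \<and> t < L (Suc n)"
proof -
  define n where "n = (LEAST n. t < L (Suc n))"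
  have "t < L (Suc t)" using strict_mono_imp_increasing[OF assms(1), of "Suc t"] by simp
  then have 1: "t < L (Suc n)" unfolding n_def by (rule LeastI)
  have "L n \<le> t"
  proof (cases n)
    case (Suc k)
    then show ?thesis using not_less_Least[of k "\<lambda>n. t < L (Suc n)"] unfolding n_def by auto
  qed (simp add: assms)
  with 1 show ?thesis by blast
qed

lemma strict_mono_block_unique:
  fixes L :: "nat \<Rightarrow> nat"
  assumes "strict_mono L" "L n \<le> t" "t < L (Suc n)" "L m \<le> t" "t < L (Suc m)"
  shows "n = m"
proof -
  have "n < Suc m" "m < Suc n"
    using assms by (meson le_less_trans strict_mono_less)+
  then show ?thesis by simp
qed

text \<open>For infinite \<open>S\<close> this extends the inverse of \<open>enumerate S\<close> to
  all positions: \<open>rank S i\<close> is the index of the first element of \<open>S\<close> that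
  is at least \<open>i\<close>.\<close>

definition rank :: "nat set \<Rightarrow> nat \<Rightarrow> nat" where
  "rank S i = card (S \<inter> {..<i})"

lemma rank_0: "rank S 0 = 0"
  by (simp add: rank_def)

lemma rank_mono: "i \<le> j \<Longrightarrow> rank S i \<le> rank S j"
  unfolding rank_def by (rule card_mono) auto

lemma rank_Suc: "rank S (Suc i) = (if i \<in> S then Suc (rank S i) else rank S i)"
  unfolding rank_def by (simp add: lessThan_Suc)

lemma rank_enumerate:
  assumes "infinite S"
  shows "rank S (enumerate S n) = n"
proof -
  have "S \<inter> {..<enumerate S n} = enumerate S ` {..<n}"
  proof (intro set_eqI iffI)
    fix x assume x: "x \<in> S \<inter> {..<enumerate S n}"
    then obtain m where "enumerate S m = x" using enumerate_Ex[OF assms] by blast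
    with x show "x \<in> enumerate S ` {..<n}" using assms by auto
  qed (use assms enumerate_in_set in auto)
  then show ?thesis
    unfolding rank_def by (simp add: card_image inj_on_subset[OF inj_enumerate[OF assms]])
qed

lemma enumerate_rank:
  assumes "infinite S" "i \<in> S"
  shows "enumerate S (rank S i) = i"
  using enumerate_Ex[OF assms] rank_enumerate[OF assms(1)] by metis

text \<open>A Galois connection: if \<open>enumerate S n < i\<close>, then the elements with indices
  \<open>0\<close> to \<open>n\<close> are all counted by \<open>rank S i\<close>.\<close>

lemma rank_le_iff:
  assumes "infinite S"
  shows "rank S i \<le> n \<longleftrightarrow> i \<le> enumerate S n"
proof
  assume "i \<le> enumerate S n"
  then show "rank S i \<le> n" using rank_mono rank_enumerate[OF assms] by metis
next
  assume le: "rank S i \<le> n"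
  show "i \<le> enumerate S n"
  proof (rule ccontr)
    assume "\<not> i \<le> enumerate S n"
    then have "rank S (Suc (enumerate S n)) \<le> rank S i" by (intro rank_mono) simp
    then show False
      using le enumerate_in_set[OF assms, of n] by (simp add: rank_Suc rank_enumerate[OF assms])
  qed
qed

text \<open>Both windows contain equally many elements of \<open>S\<close> before offset
  \<open>s\<close>; the sums avoid subtraction on the naturals.\<close>

lemma rank_shift:
  assumes "\<And>t. t < s \<Longrightarrow> a + t \<in> S \<longleftrightarrow> a' + t \<in> S"
  shows "rank S (a + s) + rank S a' = rank S (a' + s) + rank S a"
  using assms by (induction s) (auto simp: rank_Suc)

lemma enumerate_window:
  assumes S: "infinite S"
    and w: "\<And>t. t \<le> h \<Longrightarrow> a + t \<in> S \<longleftrightarrow> a' + t \<in> S"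
    and e: "enumerate S (rank S a + r) = a + s" and s: "s \<le> h"
  shows "enumerate S (rank S a' + r) = a' + s"
proof -
  have "a' + s \<in> S" using w[OF s] enumerate_in_set[OF S] e by metis
  moreover have "rank S (a + s) = rank S a + r" using rank_enumerate[OF S] e by metis
  then have "rank S (a' + s) = rank S a' + r"
    using rank_shift[of s a S a'] w s by simp
  ultimately show ?thesis using enumerate_rank[OF S] by metis
qed

subsection \<open>Occurrences and return words\<close>

lemma occurrences_prefix_iff:
  "i \<in> occurrences X (X [0 \<rightarrow> n]) \<longleftrightarrow> (\<forall>s<n. X (i + s) = X s)"
  using subsequence_eq_iff[of X i n X 0 n] by (simp add: occurrences_def)

text \<open>The letter in position \<open>x + (i + d)\<close> is read twice: at offset
  \<open>i + d\<close> of the first occurrence and at offset \<open>i\<close> of the second.\<close>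

lemma occurrences_period:
  assumes "x \<in> occurrences X (X [0 \<rightarrow> n])" "x + d \<in> occurrences X (X [0 \<rightarrow> n])" "i + d < n"
  shows "X (i + d) = X i"
proof -
  have "X (x + d + i) = X i" using assms(2,3) unfolding occurrences_prefix_iff by simp
  moreover have "X (x + (i + d)) = X (i + d)"
    using assms(1,3) unfolding occurrences_prefix_iff by simp
  ultimately show ?thesis by (simp add: ac_simps)
qed

text \<open>Turns \<open>sublist\<close> into positions: a split of the window with left part
  \<open>p\<close> puts the occurrence at offset \<open>length p\<close>.\<close>

lemma minimal_sequence_recurrence:
  assumes "minimal_sequence X"
  obtains K where "\<And>t. \<exists>i\<ge>t. i + n \<le> t + K \<and> (\<forall>s<n. X (i + s) = X (j + s))"
proof -
  obtain K where K: "\<And>u v. u \<in> factors X \<Longrightarrow> v \<in> factors X \<Longrightarrow> length u = n \<Longrightarrow>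
      length v = K \<Longrightarrow> sublist u v"
    using assms unfolding minimal_sequence_def by metis
  have "\<exists>i\<ge>t. i + n \<le> t + K \<and> (\<forall>s<n. X (i + s) = X (j + s))" for t
  proof -
    have "sublist (X [j \<rightarrow> j + n]) (X [t \<rightarrow> t + K])"
      by (rule K) (auto simp: factors_def)
    then obtain p q where pq: "X [t \<rightarrow> t + K] = p @ X [j \<rightarrow> j + n] @ q"
      unfolding sublist_def by blast
    have len: "length p + n + length q = K" using arg_cong[OF pq, of length] by simp
    have "X (t + length p + s) = X (j + s)" if "s < n" for s
      using arg_cong[OF pq, of "\<lambda>w. w ! (length p + s)"] that len
      by (simp add: nth_append add.assoc)
    then show ?thesis using len by (intro exI[of _ "t + length p"]) simp
  qed
  then show ?thesis using that by blast
qed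

text \<open>Isolates what makes \<open>enumerate\<close> list all occurrences. It is instantiated
  from minimality in one direction and from a primitive substitution in the other.\<close>

locale infinitely_occurring =
  fixes X :: "nat \<Rightarrow> 'a" and u :: "'a list"
  assumes infinite_occurrences: "infinite (occurrences X u)"
begin

abbreviation pos :: "nat \<Rightarrow> nat" where
  "pos n \<equiv> enumerate (occurrences X u) n"

lemma strict_mono_pos: "strict_mono pos"
  using infinite_occurrences by (simp add: strict_mono_def)

lemma return_factor_in_return_words: "return_factor X u n \<in> return_words X u"
proof -
  have "l \<notin> occurrences X u" if "pos n < l" "l < pos (Suc n)" for l
    using that infinite_occurrences by (metis enumerate_Ex enumerate_mono_iff not_less_eq less_antisym)
  then show ?thesis
    unfolding return_words_def return_factor_def
    using enumerate_in_set[OF infinite_occurrences] strict_monoD[OF strict_mono_pos, of n "Suc n"]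
    by blast
qed

text \<open>Successive occurrences have consecutive indices, since otherwise
  \<open>pos (Suc n)\<close> would lie strictly between them.\<close>

lemma return_words_eq: "return_words X u = range (return_factor X u)"
proof
  show "return_words X u \<subseteq> range (return_factor X u)"
  proof
    fix w assume "w \<in> return_words X u"
    then obtain i j where ij: "w = X [i \<rightarrow> j]" "i < j" "i \<in> occurrences X u" "j \<in> occurrences X u"
      "\<And>l. i < l \<Longrightarrow> l < j \<Longrightarrow> l \<notin> occurrences X u"
      unfolding return_words_def by blast
    obtain n where n: "pos n = i" using enumerate_Ex[OF infinite_occurrences ij(3)] by blast
    obtain m where m: "pos m = j" using enumerate_Ex[OF infinite_occurrences ij(4)] by blast
    have "n < m" using ij(2) n m infinite_occurrences by auto
    moreover have "\<not> Suc n < m"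
      using ij(5)[of "pos (Suc n)"] n m infinite_occurrences enumerate_in_set enumerate_mono_iff
      by blast
    ultimately have "m = Suc n" by simp
    then show "w \<in> range (return_factor X u)" using ij(1) n m by (auto simp: return_factor_def)
  qed
qed (use return_factor_in_return_words in blast)

lemma return_factor_first_appearance:
  "return_factor X u (first_appearance X u (return_factor X u n)) = return_factor X u n"
  unfolding first_appearance_def by (rule LeastI[of _ n]) simp

text \<open>A later first appearance gives a strictly larger set of predecessors, hence a larger
  index; and the first appearance determines the return word.\<close>

lemma derived_sequence_eq_iff:
  assumes fin: "finite (return_words X u)"
  shows "derived_sequence X u m = derived_sequence X u n \<longleftrightarrow>
    return_factor X u m = return_factor X u n"
proof
  assume "return_factor X u m = return_factor X u n"
  then show "derived_sequence X u m = derived_sequence X u n" by (simp add: derived_sequence_def)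
next
  let ?f = "\<lambda>m. first_appearance X u (return_factor X u m)"
  assume eq: "derived_sequence X u m = derived_sequence X u n"
  have less: "derived_sequence X u m < derived_sequence X u n" if lt: "?f m < ?f n" for m n
  proof -
    let ?R = "\<lambda>m. {v \<in> return_words X u. first_appearance X u v \<le> ?f m}"
    have "return_factor X u n \<in> ?R n - ?R m" using lt return_factor_in_return_words by simp
    moreover have "?R m \<subseteq> ?R n" using lt by auto
    ultimately have "?R m \<subset> ?R n" by blast
    then show ?thesis
      unfolding derived_sequence_def return_index_def using fin by (intro psubset_card_mono) auto
  qed
  from less[of m n] less[of n m] eq have "?f m = ?f n" by (metis less_irrefl nat_neq_iff)
  then show "return_factor X u m = return_factor X u n"
    using return_factor_first_appearance by metis
qed

lemma derived_sequence_le: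
  assumes "finite (return_words X u)"
  shows "derived_sequence X u n \<le> card (return_words X u)"
  unfolding derived_sequence_def return_index_def using assms by (intro card_mono) auto

end

text \<open>An occurrence of the prefix of length \<open>n\<close> at an offset of at most
  \<open>h\<close> lies wholly in a window of length \<open>h + n\<close>. Equal windows therefore
  show the same occurrences and the same return words between them.\<close>

lemma window:
  fixes X :: "nat \<Rightarrow> 'a" and n :: nat
  defines "S \<equiv> occurrences X (X [0 \<rightarrow> n])"
  assumes inf: "infinite S" and w: "\<And>s. s < h + n \<Longrightarrow> X (i + s) = X (j + s)"
  shows window_rank: "s \<le> h \<Longrightarrow> rank S (i + s) + rank S j = rank S (j + s) + rank S i"
    and window_enumerate: "enumerate S (rank S i + r) = i + s \<Longrightarrow> s \<le> h \<Longrightarrow>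
      enumerate S (rank S j + r) = j + s"
    and window_return_factor: "enumerate S (rank S i + Suc r) \<le> i + h \<Longrightarrow>
      return_factor X (X [0 \<rightarrow> n]) (rank S i + r) = return_factor X (X [0 \<rightarrow> n]) (rank S j + r)"
proof -
  have 1: "i + s \<in> S \<longleftrightarrow> j + s \<in> S" if "s \<le> h" for s
    using that w unfolding S_def occurrences_prefix_iff
    by (metis add.assoc add_le_less_mono)
  show "s \<le> h \<Longrightarrow> rank S (i + s) + rank S j = rank S (j + s) + rank S i"
    by (rule rank_shift) (use 1 in auto)
  have 2: "enumerate S (rank S j + r) = j + s" if "enumerate S (rank S i + r) = i + s" "s \<le> h" for r s
    using enumerate_window[OF inf 1 that] by blast
  then show "enumerate S (rank S i + r) = i + s \<Longrightarrow> s \<le> h \<Longrightarrow> enumerate S (rank S j + r) = j + s" .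
  assume le: "enumerate S (rank S i + Suc r) \<le> i + h"
  \<comment> \<open>\<open>p r\<close> is the offset of occurrence number \<open>r\<close> counted
    from \<open>i\<close>. The subtraction is exact by \<open>rank_le_iff\<close>.\<close>
  define p where "p r = enumerate S (rank S i + r) - i" for r
  have p: "enumerate S (rank S i + r) = i + p r" for r
    using rank_le_iff[OF inf, of i "rank S i + r"] by (simp add: p_def)
  have lt: "p r < p (Suc r)" using enumerate_step[OF inf, of "rank S i + r"] p[of r] p[of "Suc r"] by simp
  have ps: "p (Suc r) \<le> h" using le p[of "Suc r"] by simp
  have q: "enumerate S (rank S j + r) = j + p r"
    "enumerate S (Suc (rank S j + r)) = j + p (Suc r)"
    using 2[OF p, of r] 2[OF p, of "Suc r"] lt ps by auto
  have "X [i + p r \<rightarrow> i + p (Suc r)] = X [j + p r \<rightarrow> j + p (Suc r)]"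
    using subsequence_eq_iff[of X "i + p r" "p (Suc r) - p r" X "j + p r" "p (Suc r) - p r"]
      lt ps w by (simp add: add.assoc)
  then show "return_factor X (X [0 \<rightarrow> n]) (rank S i + r) = return_factor X (X [0 \<rightarrow> n]) (rank S j + r)"
    using p[of r] p[of "Suc r"] q unfolding return_factor_def S_def by simp
qed

section \<open>Bounded gaps between occurrences in a minimal sequence\<close>

lemma minimal_sequence_gap:
  assumes "minimal_sequence X"
  obtains K where "infinite (occurrences X (X [0 \<rightarrow> n]))"
    "\<And>m. enumerate (occurrences X (X [0 \<rightarrow> n])) (Suc m)
      \<le> enumerate (occurrences X (X [0 \<rightarrow> n])) m + K"
proof -
  let ?O = "occurrences X (X [0 \<rightarrow> n])"
  obtain K where K: "\<And>t. \<exists>i\<ge>t. i + n \<le> t + K \<and> (\<forall>s<n. X (i + s) = X (0 + s))"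
    using minimal_sequence_recurrence[OF assms] by blast
  have occ: "\<exists>i\<in>?O. t \<le> i \<and> i \<le> t + K" for t
    using K[of t] by (fastforce simp: occurrences_prefix_iff)
  have inf: "infinite ?O" unfolding infinite_nat_iff_unbounded_le using occ by blast
  \<comment> \<open>The search for the next occurrence starts one position after the current one,
    hence \<open>Suc K\<close>.\<close>
  have "enumerate ?O (Suc m) \<le> enumerate ?O m + Suc K" for m
  proof -
    obtain i where "i \<in> ?O" "Suc (enumerate ?O m) \<le> i" "i \<le> Suc (enumerate ?O m) + K"
      using occ by blast
    then show ?thesis unfolding enumerate_Suc''[OF inf]
      by (intro order_trans[OF Least_le[of _ i]]) auto
  qed
  with inf that show ?thesis by blast
qed

lemma enumerate_occurrences_0:
  assumes "infinite (occurrences X (X [0 \<rightarrow> n]))"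
  shows "enumerate (occurrences X (X [0 \<rightarrow> n])) 0 = 0"
  using enumerate_rank[OF assms, of 0] by (simp add: occurrences_prefix_iff rank_0)

text \<open>Bounded gaps bound the lengths of the return words, and there are finitely many
  letters.\<close>

lemma finite_return_words:
  assumes "finite (range X)" "minimal_sequence X"
  shows "finite (return_words X (X [0 \<rightarrow> n]))"
proof -
  obtain K where inf: "infinite (occurrences X (X [0 \<rightarrow> n]))"
    and K: "\<And>m. enumerate (occurrences X (X [0 \<rightarrow> n])) (Suc m)
      \<le> enumerate (occurrences X (X [0 \<rightarrow> n])) m + K"
    using minimal_sequence_gap[OF assms(2)] by blast
  interpret infinitely_occurring X "X [0 \<rightarrow> n]" by unfold_locales (rule inf)
  have "return_words X (X [0 \<rightarrow> n]) \<subseteq> {w. set w \<subseteq> range X \<and> length w \<le> K}"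
    using K by (auto simp: return_words_eq return_factor_def le_diff_conv add.commute)
  then show ?thesis using finite_lists_length_le[OF assms(1)] finite_subset by blast
qed

subsection \<open>Finitely many derived sequences\<close>

text \<open>\<open>c n\<close> is the position in \<open>Z\<close> at which the image of \<open>Z n\<close> starts.\<close>

lemma substitutive_primitive_blocks:
  fixes X :: "nat \<Rightarrow> 'a" and Z :: "nat \<Rightarrow> 'b" and c :: "nat \<Rightarrow> nat"
  assumes A: "range X \<subseteq> A" and fin: "finite (range Z)"
    and X_Z: "\<And>s t. Z s = Z t \<Longrightarrow> X s = X t"
    and c: "strict_mono c" "c 0 = 0" "1 < c 1"
    and block: "\<And>s t. Z s = Z t \<Longrightarrow> Z [c s \<rightarrow> c (Suc s)] = Z [c t \<rightarrow> c (Suc t)]"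
    and prim: "\<And>s t. \<exists>i. (c ^^ k) t \<le> i \<and> i < (c ^^ k) (Suc t) \<and> Z i = Z s"
  shows "substitutive_primitive A X"
proof -
  \<comment> \<open>\<open>inv Z\<close> picks a position that carries the given letter; by
    \<open>block\<close> and \<open>X_Z\<close> the choice does not matter.\<close>
  define \<zeta> where "\<zeta> \<beta> = Z [c (inv Z \<beta>) \<rightarrow> c (Suc (inv Z \<beta>))]" for \<beta>
  define \<phi> where "\<phi> \<beta> = X (inv Z \<beta>)" for \<beta>
  have inv: "Z (inv Z (Z t)) = Z t" for t by (simp add: f_inv_into_f)
  have \<zeta>: "\<zeta> (Z t) = Z [c t \<rightarrow> c (Suc t)]" for t unfolding \<zeta>_def by (rule block[OF inv])
  have \<phi>: "\<phi> (Z t) = X t" for t unfolding \<phi>_def by (rule X_Z[OF inv])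
  have mono: "c i \<le> c j" if "i \<le> j" for i j using c(1) that by (simp add: strict_mono_less_eq)
  \<comment> \<open>The substitution acts on positions as \<open>c\<close>, so its iterates are
    governed by the iterates of \<open>c\<close>.\<close>
  have ext: "extend_word \<zeta> (Z [i \<rightarrow> j]) = Z [c i \<rightarrow> c j]" if "i \<le> j" for i j
    using that
  proof (induction j rule: dec_induct)
    case (step j)
    have "extend_word \<zeta> (Z [i \<rightarrow> Suc j]) = extend_word \<zeta> (Z [i \<rightarrow> j]) @ \<zeta> (Z j)"
      using step(1) by (subst subsequence_split[of i j]) (auto simp: extend_word_def)
    also have "\<dots> = Z [c i \<rightarrow> c (Suc j)]"
      using step by (subst subsequence_split[of "c i" "c j"]) (auto simp: \<zeta> mono)
    finally show ?case .
  qed (simp add: extend_word_def)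
  have smono: "strict_mono (c ^^ n)" for n
    by (induction n) (use c(1) in \<open>auto simp: strict_mono_def\<close>)
  have it: "iterate \<zeta> n (Z t) = Z [(c ^^ n) t \<rightarrow> (c ^^ n) (Suc t)]" for n t
  proof (induction n)
    case (Suc n)
    have "(c ^^ n) t \<le> (c ^^ n) (Suc t)" using smono by (simp add: strict_mono_less_eq)
    then show ?case by (simp add: iterate_Suc Suc ext)
  qed (simp add: iterate_0)
  have c0: "(c ^^ n) 0 = 0" for n by (induction n) (simp_all add: c(2))
  \<comment> \<open>Since \<open>c\<close> is strictly increasing, \<open>1 < c 1\<close> gives
    \<open>i < c i\<close> for all \<open>i\<close> from \<open>1\<close> on, so the iterates of the
    first letter grow.\<close>
  have c1: "Suc n \<le> (c ^^ n) 1" for n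
  proof (induction n)
    case (Suc n)
    have "Suc i \<le> c i" if "1 \<le> i" for i using that
    proof (induction i rule: dec_induct)
      case (step i)
      then show ?case using strict_monoD[OF c(1), of i "Suc i"] by simp
    qed (use c(3) in simp)
    from this[of "(c ^^ n) 1"] Suc show ?case by simp
  qed simp
  have len: "Suc n \<le> length (iterate \<zeta> n (Z 0))" for n
    using c1[of n] by (simp add: it c0)
  have "filterlim (\<lambda>n. length (iterate \<zeta> n (Z 0))) at_top sequentially"
    by (rule filterlim_at_top_mono[OF filterlim_ident])
      (intro always_eventually allI Suc_leD[OF len])
  moreover have "\<zeta> (Z t) \<noteq> []" "set (\<zeta> (Z t)) \<subseteq> range Z" for t
    using strict_monoD[OF c(1), of t "Suc t"] by (auto simp: \<zeta>)
  moreover have "hd (\<zeta> (Z 0)) = Z 0"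
  proof -
    have "Z [0 \<rightarrow> c 1] = [Z 0] @ Z [1 \<rightarrow> c 1]"
      using subsequence_split[of 0 1 "c 1" Z] c(3) by simp
    then show ?thesis by (simp add: \<zeta> c(2))
  qed
  ultimately have sub: "substitution \<zeta> (range Z) (Z 0)"
    using fin by (auto simp: substitution_def)
  have "\<gamma> \<in> set (iterate \<zeta> k \<beta>)" if "\<beta> \<in> range Z" "\<gamma> \<in> range Z" for \<beta> \<gamma>
  proof -
    from that obtain s t where "\<gamma> = Z s" "\<beta> = Z t" by blast
    moreover obtain i where "(c ^^ k) t \<le> i" "i < (c ^^ k) (Suc t)" "Z i = Z s"
      using prim by blast
    ultimately show ?thesis by (auto simp: it intro!: image_eqI[of _ _ i])
  qed
  then have "primitive_substitution \<zeta> (range Z) (Z 0)"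
    using sub unfolding primitive_substitution_def by blast
  moreover have "\<phi> ` range Z \<subseteq> A" using A by (auto simp: \<phi>)
  moreover have "\<phi> \<circ> fixed_point \<zeta> (Z 0) = X"
  proof
    fix i
    have "fixed_point \<zeta> (Z 0) i = Z i"
      using fixed_point_nth[OF sub, of i i] len[of i] by (simp add: it c0)
    then show "(\<phi> \<circ> fixed_point \<zeta> (Z 0)) i = X i" by (simp add: \<phi>)
  qed
  ultimately show ?thesis by (rule substitutive_primitiveI)
qed

text \<open>The letters are the residues modulo \<open>d\<close>, and each is sent to the list of
  all residues in order, written twice. Doubling makes the images grow even for
  \<open>d = 1\<close>.\<close>

lemma periodic_substitutive_primitive:
  assumes "periodic X" "range X \<subseteq> A"
  shows "substitutive_primitive A X"
proof -
  from assms(1) obtain d where d: "d > 0" "\<And>i. X (i + d) = X i" unfolding periodic_def by blast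
  have shift: "(2 * d * s + i) mod d = i mod d" for s i
    using mod_mult_self4[of d "2 * s" i] by (simp add: ac_simps)
  show ?thesis
  proof (rule substitutive_primitive_blocks[where Z = "\<lambda>n. n mod d" and c = "\<lambda>n. 2 * d * n" and k = 1,
        OF assms(2)])
    show "finite (range (\<lambda>n. n mod d))"
      by (rule finite_subset[of _ "{..<d}"]) (use d(1) in auto)
    show "X s = X t" if "s mod d = t mod d" for s t
      using that mod_period[of X d] d(2) by metis
    show "strict_mono (\<lambda>n. 2 * d * n)" using d(1) by (simp add: strict_mono_def)
    show "(\<lambda>n. n mod d) [2 * d * s \<rightarrow> 2 * d * Suc s] = (\<lambda>n. n mod d) [2 * d * t \<rightarrow> 2 * d * Suc t]"
      for s t
      using subsequence_eq_iff[of "\<lambda>n. n mod d" "2 * d * s" "2 * d" "\<lambda>n. n mod d" "2 * d * t" "2 * d"]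
      by (simp only: mult_Suc_right add.commute[of "2 * d"] shift simp_thms)
    show "\<exists>i\<ge>((\<lambda>n. 2 * d * n) ^^ 1) t. i < ((\<lambda>n. 2 * d * n) ^^ 1) (Suc t) \<and> i mod d = s mod d"
      for s t
      by (rule exI[of _ "2 * d * t + s mod d"])
        (use mod_less_divisor[OF d(1), of s] in \<open>simp add: shift\<close>)
  qed (use d(1) in auto)
qed

text \<open>Each positive \<open>d < G\<close> fails to be a period at some place. A prefix that
  covers all these places cannot recur at a distance below \<open>G\<close>, by
  \<open>occurrences_period\<close>.\<close>

lemma nonperiodic_gap:
  assumes "\<not> periodic X"
  obtains N where "\<And>n x y. N \<le> n \<Longrightarrow> x \<in> occurrences X (X [0 \<rightarrow> n]) \<Longrightarrow>
    y \<in> occurrences X (X [0 \<rightarrow> n]) \<Longrightarrow> x < y \<Longrightarrow> x + G \<le> y"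
proof -
  have "\<exists>i. d > 0 \<longrightarrow> X (i + d) \<noteq> X i" for d using assms unfolding periodic_def by blast
  then obtain i where i: "\<And>d. d > 0 \<Longrightarrow> X (i d + d) \<noteq> X (i d)" by metis
  have "finite ((\<lambda>d. i d + d) ` {..<G})" by simp
  then obtain N where N: "\<And>d. d < G \<Longrightarrow> i d + d < N"
    unfolding finite_nat_iff_bounded by blast
  have "x + G \<le> y" if "N \<le> n" "x \<in> occurrences X (X [0 \<rightarrow> n])" "y \<in> occurrences X (X [0 \<rightarrow> n])"
    "x < y" for n x y
  proof (rule ccontr)
    assume "\<not> x + G \<le> y"
    then have d: "y - x < G" "0 < y - x" "x + (y - x) = y" using that(4) by auto
    then show False
      using occurrences_period[of x X n "y - x" "i (y - x)"] that N[OF d(1)] i[OF d(2)] by simp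
  qed
  then show ?thesis using that by blast
qed

text \<open>Supplies primitivity of the substitution constructed below. Each return word recurs by
  minimality, and one \<open>K\<close> serves all \<open>j\<close> because \<open>D\<close> takes
  finitely many values.\<close>

lemma minimal_sequence_derived_recurrence:
  fixes X :: "nat \<Rightarrow> 'a" and n :: nat
  defines "S \<equiv> occurrences X (X [0 \<rightarrow> n])" and "D \<equiv> derived_sequence X (X [0 \<rightarrow> n])"
  assumes "finite (range X)" "minimal_sequence X"
  obtains K where "\<And>t j. \<exists>m. t \<le> enumerate S m \<and> enumerate S (Suc m) \<le> t + K \<and> D m = D j"
proof -
  obtain K0 where inf: "infinite S"
    using minimal_sequence_gap[OF assms(4), of n] unfolding S_def by blast
  interpret infinitely_occurring X "X [0 \<rightarrow> n]" by unfold_locales (rule inf[unfolded S_def])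
  have fin: "finite (return_words X (X [0 \<rightarrow> n]))" using finite_return_words assms(3,4) by blast
  have "\<exists>K. \<forall>t. \<exists>m. t \<le> enumerate S m \<and> enumerate S (Suc m) \<le> t + K \<and> D m = D j" for j
  proof -
    \<comment> \<open>\<open>?h\<close> is the length of return word number \<open>j\<close>; a
      window of length \<open>?h + n\<close> also shows the occurrence that ends it.\<close>
    let ?a = "enumerate S j" and ?h = "enumerate S (Suc j) - enumerate S j"
    have a: "enumerate S (Suc j) = ?a + ?h" using enumerate_step[OF inf, of j] by simp
    have rank: "rank S ?a = j" by (rule rank_enumerate[OF inf])
    obtain K where K: "\<And>t. \<exists>i\<ge>t. i + (?h + n) \<le> t + K \<and> (\<forall>s<?h + n. X (i + s) = X (?a + s))"
      using minimal_sequence_recurrence[OF assms(4)] by blast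
    have "\<exists>m. t \<le> enumerate S m \<and> enumerate S (Suc m) \<le> t + K \<and> D m = D j" for t
    proof -
      from K[of t] obtain i where i: "t \<le> i" "i + (?h + n) \<le> t + K"
        "\<And>s. s < ?h + n \<Longrightarrow> X (?a + s) = X (i + s)" by metis
      have 1: "enumerate S (rank S i) = i"
        using window_enumerate[OF inf[unfolded S_def] i(3)[unfolded S_def], where h = ?h and r = 0 and s = 0]
        by (simp flip: S_def add: rank)
      have 2: "enumerate S (Suc (rank S i)) = i + ?h"
        using window_enumerate[OF inf[unfolded S_def] i(3)[unfolded S_def], where h = ?h and r = 1 and s = ?h] a
        by (simp flip: S_def add: rank)
      have "return_factor X (X [0 \<rightarrow> n]) j = return_factor X (X [0 \<rightarrow> n]) (rank S i)"
        using window_return_factor[OF inf[unfolded S_def] i(3)[unfolded S_def], where h = ?h and r = 0] a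
        by (simp flip: S_def add: rank)
      then have "D (rank S i) = D j" unfolding D_def derived_sequence_eq_iff[OF fin] by simp
      then show ?thesis using 1 2 i by (intro exI[of _ "rank S i"]) simp
    qed
    then show ?thesis by blast
  qed
  then obtain K where
    K: "\<And>j t. \<exists>m. t \<le> enumerate S m \<and> enumerate S (Suc m) \<le> t + K j \<and> D m = D j" by metis
  have "range D \<subseteq> {..card (return_words X (X [0 \<rightarrow> n]))}"
    using derived_sequence_le[OF fin] unfolding D_def by auto
  then obtain N where N: "\<And>j. \<exists>m<N. D m = D j"
    using finite_range_bounded finite_subset finite_atMost by metis
  \<comment> \<open>The values of \<open>D\<close> are represented below \<open>N\<close>, so the
    sum of their bounds is a common bound.\<close>
  have "\<exists>m. t \<le> enumerate S m \<and> enumerate S (Suc m) \<le> t + sum K {..<N} \<and> D m = D j" for t j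
  proof -
    obtain j' where j': "j' < N" "D j' = D j" using N by blast
    have "K j' \<le> sum K {..<N}" using j' by (intro member_le_sum) auto
    then show ?thesis using K[of t j'] j'(2) by (metis add_le_mono le_refl order_trans)
  qed
  then show ?thesis using that by blast
qed

lemma finite_derived_substitutive_primitive:
  assumes A: "finite A" "range X \<subseteq> A" and min: "minimal_sequence X" and np: "\<not> periodic X"
    and fin_der: "finite {derived_sequence X u | u. u \<in> nonempty_prefixes X}"
  shows "substitutive_primitive A X"
proof -
  have finX: "finite (range X)" using A finite_subset by blast
  let ?D = "\<lambda>l. derived_sequence X (X [0 \<rightarrow> l])"
  have "?D ` {0<..} \<subseteq> {derived_sequence X u | u. u \<in> nonempty_prefixes X}"
    unfolding nonempty_prefixes_def by fastforce
  \<comment> \<open>Pigeonhole: some derived sequence belongs to prefixes of infinitely many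
    lengths, so the second prefix can be taken as long as needed.\<close>
  then obtain l where l: "0 < l" "infinite {l' \<in> {0<..}. ?D l' = ?D l}"
    using pigeonhole_infinite[OF infinite_Ioi, of ?D 0] fin_der finite_subset by auto
  define S where "S = occurrences X (X [0 \<rightarrow> l])"
  define a where "a = enumerate S"
  define D where "D = ?D l"
  obtain R where inf: "infinite S" and R: "\<And>m. a (Suc m) \<le> a m + R"
    using minimal_sequence_gap[OF min, of l] unfolding S_def a_def by blast
  obtain K where K: "\<And>t j. \<exists>m. t \<le> a m \<and> a (Suc m) \<le> t + K \<and> D m = D j"
    using minimal_sequence_derived_recurrence[OF finX min, of l] unfolding S_def a_def D_def by metis
  \<comment> \<open>\<open>R * R\<close> gives each long return word at least \<open>R\<close> short
    ones (\<open>g_gap\<close>), \<open>K\<close> makes it contain every letter of \<open>D\<close>,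
    and \<open>2\<close> yields \<open>1 < c 1\<close>.\<close>
  define G where "G = R * R + K + 2"
  obtain N where N: "\<And>n x y. N \<le> n \<Longrightarrow> x \<in> occurrences X (X [0 \<rightarrow> n]) \<Longrightarrow>
    y \<in> occurrences X (X [0 \<rightarrow> n]) \<Longrightarrow> x < y \<Longrightarrow> x + G \<le> y"
    using nonperiodic_gap[OF np] by blast
  obtain l' where l': "max l N \<le> l'" "?D l' = D"
    using l(2) unfolding D_def infinite_nat_iff_unbounded_le by blast
  define S' where "S' = occurrences X (X [0 \<rightarrow> l'])"
  define b where "b = enumerate S'"
  have inf': "infinite S'" using minimal_sequence_gap[OF min, of l'] unfolding S'_def by blast
  interpret u: infinitely_occurring X "X [0 \<rightarrow> l]" by unfold_locales (use inf in \<open>simp add: S_def\<close>)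
  interpret v: infinitely_occurring X "X [0 \<rightarrow> l']" by unfold_locales (use inf' in \<open>simp add: S'_def\<close>)
  have a_mono: "strict_mono a" unfolding a_def S_def by (rule u.strict_mono_pos)
  have b_mono: "strict_mono b" unfolding b_def S'_def by (rule v.strict_mono_pos)
  have a_0: "a 0 = 0" using enumerate_occurrences_0 inf unfolding a_def S_def by blast
  have b_0: "b 0 = 0" using enumerate_occurrences_0 inf' unfolding b_def S'_def by blast
  have a_step: "a n < a (Suc n)" for n using a_mono by (simp add: strict_mono_less)
  have b_step: "b n < b (Suc n)" for n using b_mono by (simp add: strict_mono_less)
  have b_S': "b n \<in> S'" for n unfolding b_def by (rule enumerate_in_set[OF inf'])
  have b_gap: "b n + G \<le> b (Suc n)" for n
    using N[of l' "b n" "b (Suc n)"] l'(1) b_S' b_step unfolding S'_def by simp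
  have "b n \<in> S" for n using b_S'[of n] l'(1) unfolding S_def S'_def occurrences_prefix_iff by simp
  \<comment> \<open>The long return word number \<open>n\<close> begins with the short return word
    number \<open>g n\<close>.\<close>
  define g where "g n = rank S (b n)" for n
  have a_g: "a (g n) = b n" for n unfolding a_def g_def using enumerate_rank[OF inf \<open>b n \<in> S\<close>] .
  have g_step: "g n < g (Suc n)" for n
    using b_step[of n] a_mono unfolding a_g[symmetric] by (simp add: strict_mono_less)
  then have g_mono: "strict_mono g" by (simp add: strict_mono_Suc_iff)
  have g_0: "g 0 = 0" unfolding g_def b_0 by (rule rank_0)
  have a_le: "a (n + k) \<le> a n + R * k" for n k
  proof (induction k)
    case (Suc k)
    then show ?case using R[of "n + k"] by simp
  qed simp
  have g_gap: "g n + R \<le> g (Suc n)" for n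
  proof (rule ccontr)
    assume "\<not> g n + R \<le> g (Suc n)"
    then have "R * (g (Suc n) - g n) \<le> R * R" by (intro mult_le_mono) linarith+
    moreover have "b (Suc n) \<le> b n + R * (g (Suc n) - g n)"
      using a_le[of "g n" "g (Suc n) - g n"] g_step[of n] by (simp add: a_g)
    ultimately show False using b_gap[of n] unfolding G_def by linarith
  qed
  have D_u: "return_factor X (X [0 \<rightarrow> l]) m = return_factor X (X [0 \<rightarrow> l]) n \<longleftrightarrow> D m = D n" for m n
    unfolding D_def using u.derived_sequence_eq_iff[OF finite_return_words[OF finX min]] by blast
  \<comment> \<open>Here the equality of the two derived sequences enters: the letters of
    \<open>D\<close> name the return words over both prefixes.\<close>
  have D_v: "return_factor X (X [0 \<rightarrow> l']) m = return_factor X (X [0 \<rightarrow> l']) n \<longleftrightarrow> D m = D n" for m n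
    using v.derived_sequence_eq_iff[OF finite_return_words[OF finX min]] l'(2) by metis
  have D_a: "a (Suc m) - a m = a (Suc n) - a n" "s < a (Suc m) - a m \<Longrightarrow> X (a m + s) = X (a n + s)"
    if "D m = D n" for m n s
  proof -
    have "X [a m \<rightarrow> a (Suc m)] = X [a n \<rightarrow> a (Suc n)]"
      using that unfolding D_u[symmetric] return_factor_def by (fold S_def a_def)
    from subsequence_eqD[OF this] show "a (Suc m) - a m = a (Suc n) - a n"
      "s < a (Suc m) - a m \<Longrightarrow> X (a m + s) = X (a n + s)"
      using a_step less_imp_le by blast+
  qed
  have D_g: "g (Suc m) + g n = g (Suc n) + g m" "r < g (Suc m) - g m \<Longrightarrow> D (g m + r) = D (g n + r)"
    if eq: "D m = D n" for m n r
  proof -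
    let ?h = "b (Suc m) - b m"
    have bm: "b (Suc m) = b m + ?h" using b_step[of m] by simp
    have "X [b m \<rightarrow> b (Suc m)] = X [b n \<rightarrow> b (Suc n)]"
      using that unfolding D_v[symmetric] return_factor_def by (fold S'_def b_def)
    from subsequence_eqD[OF this] b_step
    have h: "?h = b (Suc n) - b n" and X: "\<And>s. s < ?h \<Longrightarrow> X (b m + s) = X (b n + s)"
      using less_imp_le by blast+
    have bn: "b (Suc n) = b n + ?h" using b_step[of n] h by simp
    \<comment> \<open>Each long return word is followed by the long prefix. This prolongs the
      agreement by \<open>l\<close> letters, so that short occurrences at the right end are seen as
      well.\<close>
    have X': "X (b m + s) = X (b n + s)" if "s < ?h + l" for s
    proof (cases "s < ?h")
      case False
      then obtain s' where s': "s = ?h + s'" by (metis le_Suc_ex not_less)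
      then have "s' < l'" using that l'(1) by simp
      then have "X (b (Suc m) + s') = X (b (Suc n) + s')"
        using b_S'[of "Suc m"] b_S'[of "Suc n"] unfolding S'_def occurrences_prefix_iff by simp
      then show ?thesis using bm bn s' by (metis add.assoc)
    qed (rule X)
    note w = inf[unfolded S_def] X'
    show "g (Suc m) + g n = g (Suc n) + g m"
      using window_rank[OF w, where h = ?h and s = ?h] bm bn unfolding g_def S_def by simp
    assume r: "r < g (Suc m) - g m"
    then have "Suc (g m + r) \<le> g (Suc m)" by simp
    then have "a (Suc (g m + r)) \<le> b (Suc m)"
      unfolding a_g[symmetric] using a_mono by (simp add: strict_mono_less_eq)
    then have "enumerate (occurrences X (X [0 \<rightarrow> l])) (rank (occurrences X (X [0 \<rightarrow> l])) (b m) + Suc r)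
      \<le> b m + ?h" using bm by (simp add: a_def g_def S_def)
    from window_return_factor[OF w, where h = ?h, OF _ this]
    show "D (g m + r) = D (g n + r)" unfolding D_u[symmetric] by (simp add: g_def S_def)
  qed
  obtain bl where bl: "\<And>t. a (bl t) \<le> t" "\<And>t. t < a (Suc (bl t))"
    using strict_mono_block[OF a_mono a_0] by metis
  have bl_eq: "bl t = n" if "a n \<le> t" "t < a (Suc n)" for t n
    using strict_mono_block_unique[OF a_mono bl that] by blast
  have bl_a: "bl (a n) = n" for n by (rule bl_eq) (simp_all add: a_step)
  \<comment> \<open>\<open>Z t\<close> is the index of the return word over \<open>u = X [0 \<rightarrow> l]\<close> that covers \<open>t\<close>, with the offset of \<open>t\<close>
    in it. The image of the letter with offset \<open>i\<close> is return word number \<open>i\<close> over \<open>u\<close> in the corresponding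
    return word over \<open>X [0 \<rightarrow> l']\<close>; the last offset gets all the remaining ones. This needs
    \<open>g_gap\<close>.\<close>
  define Z where "Z t = (D (bl t), t - a (bl t))" for t
  define J where "J t = g (bl t) + (t - a (bl t))" for t
  define c where "c t = a (J t)" for t
  define k where "k t = (if Suc t < a (Suc (bl t)) then 1
    else g (Suc (bl t)) - g (bl t) - (t - a (bl t)))" for t
  have off: "t - a (bl t) < R" for t using bl[of t] R[of "bl t"] by linarith
  have J_lt: "J t < g (Suc (bl t))" for t using off[of t] g_gap[of "bl t"] unfolding J_def by linarith
  then have k_pos: "0 < k t" for t unfolding k_def J_def using less_diff_conv2 by fastforce
  have J_k: "J t + k t \<le> g (Suc (bl t))" for t
    using J_lt[of t] unfolding k_def J_def by auto
  have J_Suc: "J (Suc t) = J t + k t" for t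
  proof (cases "Suc t < a (Suc (bl t))")
    case True
    then have "bl (Suc t) = bl t" using bl[of t] by (intro bl_eq) auto
    then show ?thesis using True bl[of t] unfolding J_def k_def by simp
  next
    case False
    then have "Suc t = a (Suc (bl t))" using bl[of t] by simp
    then have "J (Suc t) = g (Suc (bl t))" unfolding J_def using bl_a by simp
    then show ?thesis using False J_lt[of t] unfolding k_def J_def by simp
  qed
  have J_a: "J (a n) = g n" for n unfolding J_def bl_a by simp
  have c_a: "c (a n) = b n" for n unfolding c_def J_a a_g ..
  have Z_block: "Z [a m \<rightarrow> a (Suc m)] = Z [a n \<rightarrow> a (Suc n)]" if "D m = D n" for m n
  proof -
    have "Z (a i + s) = (D i, s)" if "s < a (Suc i) - a i" for i s
      using bl_eq[of i "a i + s"] that unfolding Z_def by simp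
    then show ?thesis
      using that D_a(1)[OF that] a_step[of m] a_step[of n] by (intro subsequence_eqI) simp_all
  qed
  have Z_blocks: "Z [a m \<rightarrow> a (m + k)] = Z [a n \<rightarrow> a (n + k)]" if "\<And>i. i < k \<Longrightarrow> D (m + i) = D (n + i)"
    for m n k
    using that
  proof (induction k)
    case (Suc k)
    have "Z [a i \<rightarrow> a (i + Suc k)] = Z [a i \<rightarrow> a (i + k)] @ Z [a (i + k) \<rightarrow> a (Suc (i + k))]" for i
      using subsequence_split[of "a i" "a (i + k)" "a (i + Suc k)" Z] a_mono
      by (simp add: strict_mono_less_eq)
    then show ?case using Suc Z_block[of "m + k" "n + k"] by simp
  qed simp
  show ?thesis
  proof (rule substitutive_primitive_blocks[where Z = Z and c = c and k = 2, OF A(2)])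
    have "Z t \<in> {..card (return_words X (X [0 \<rightarrow> l]))} \<times> {..R}" for t
      using u.derived_sequence_le[OF finite_return_words[OF finX min]] off[of t]
      unfolding Z_def D_def by simp
    then have "range Z \<subseteq> {..card (return_words X (X [0 \<rightarrow> l]))} \<times> {..R}" by blast
    then show "finite (range Z)" by (rule finite_subset) simp
    show "X s = X t" if "Z s = Z t" for s t
    proof -
      from that have e: "D (bl s) = D (bl t)" "s - a (bl s) = t - a (bl t)" by (simp_all add: Z_def)
      have "X (a (bl s) + (s - a (bl s))) = X (a (bl t) + (s - a (bl s)))"
        by (rule D_a(2)[OF e(1)]) (use bl[of s] in simp)
      moreover have "a (bl s) + (s - a (bl s)) = s" "a (bl t) + (s - a (bl s)) = t"
        using bl(1)[of s] bl(1)[of t] e(2) by simp_all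
      ultimately show ?thesis by simp
    qed
    show "strict_mono c"
      unfolding strict_mono_Suc_iff c_def J_Suc using k_pos a_mono by (simp add: strict_mono_less)
    show "c 0 = 0" using c_a[of 0] by (simp add: a_0 b_0)
    show "1 < c 1"
    proof (cases "1 < a 1")
      case True
      have "1 \<le> J 1" using J_Suc[of 0] k_pos[of 0] by simp
      then have "a 1 \<le> c 1" unfolding c_def using a_mono by (simp only: strict_mono_less_eq)
      with True show ?thesis by simp
    next
      case False
      then have "a 1 = 1" using a_step[of 0] by simp
      then have "c 1 = b 1" using c_a[of 1] by simp
      then show ?thesis using b_gap[of 0] unfolding G_def by simp
    qed
    show "Z [c s \<rightarrow> c (Suc s)] = Z [c t \<rightarrow> c (Suc t)]" if "Z s = Z t" for s t
    proof -
      from that have e: "D (bl s) = D (bl t)" "s - a (bl s) = t - a (bl t)" by (simp_all add: Z_def)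
      have "Suc s < a (Suc (bl s)) \<longleftrightarrow> Suc t < a (Suc (bl t))"
        using D_a(1)[OF e(1)] e(2) bl(1)[of s] bl(1)[of t] by linarith
      moreover have "g (Suc (bl s)) - g (bl s) = g (Suc (bl t)) - g (bl t)"
        using D_g(1)[OF e(1)] g_step[of "bl s"] g_step[of "bl t"] by linarith
      ultimately have "k s = k t" unfolding k_def e(2) by simp
      moreover have "D (J s + i) = D (J t + i)" if "i < k s" for i
      proof -
        have "(s - a (bl s)) + i < g (Suc (bl s)) - g (bl s)"
          using that J_k[of s] unfolding J_def by linarith
        from D_g(2)[OF e(1) this] show ?thesis unfolding J_def e(2) by (simp add: add.assoc)
      qed
      ultimately show ?thesis unfolding c_def J_Suc using Z_blocks[of "k s" "J s" "J t"] by simp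
    qed
    show "\<exists>i\<ge>(c ^^ 2) t. i < (c ^^ 2) (Suc t) \<and> Z i = Z s" for s t
    proof -
      \<comment> \<open>One application of \<open>c\<close> leads to the start of a short return
        word, a second one to the start of a long one. The second image of a letter thus spans a
        whole long return word, which contains all letters.\<close>
      have c2: "(c ^^ 2) t = b (J t)" for t unfolding numeral_2_eq_2 using c_a by (simp add: c_def[of t])
      obtain m where m: "b (J t) \<le> a m" "a (Suc m) \<le> b (J t) + K" "D m = D (bl s)" using K by blast
      let ?i = "a m + (s - a (bl s))"
      have i: "?i < a (Suc m)" using bl[of s] D_a(1)[OF m(3)] by linarith
      have "bl ?i = m" by (rule bl_eq) (use i in auto)
      then have "Z ?i = Z s" unfolding Z_def using m(3) by simp
      moreover have "b (J t) + K \<le> b (Suc (J t))" using b_gap[of "J t"] unfolding G_def by simp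
      moreover have "b (Suc (J t)) \<le> b (J (Suc t))"
        using b_mono k_pos[of t] unfolding J_Suc by (simp add: strict_mono_less_eq)
      ultimately show ?thesis unfolding c2 using m(1,2) i by (intro exI[of _ ?i]) auto
    qed
  qed
qed

subsection \<open>Derived sequences of primitive substitutive sequences\<close>

lemma derived_sequence_cong:
  assumes "occurrences X u = occurrences X v"
  shows "derived_sequence X u = derived_sequence X v"
proof -
  have "return_words X u = return_words X v" unfolding return_words_def assms ..
  moreover have "return_factor X u = return_factor X v" unfolding return_factor_def assms ..
  ultimately show ?thesis
    by (simp add: fun_eq_iff derived_sequence_def return_index_def first_appearance_def)
qed

text \<open>A prefix longer than the period \<open>d\<close> occurs exactly where the prefix of
  length \<open>d\<close> does, and the derived sequence depends only on the occurrences.\<close>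

lemma periodic_finite_derived:
  assumes "periodic X"
  shows "finite {derived_sequence X u | u. u \<in> nonempty_prefixes X}"
proof -
  from assms obtain d where d: "d > 0" "\<And>i. X (i + d) = X i" unfolding periodic_def by blast
  have "occurrences X (X [0 \<rightarrow> n]) = occurrences X (X [0 \<rightarrow> min n d])" for n
  proof (cases "d \<le> n")
    case True
    have "X (i + s) = X s" if "\<And>s. s < d \<Longrightarrow> X (i + s) = X s" for i s
    proof -
      have "X (i + s) = X (i + s mod d)"
        using mod_period[of "\<lambda>s. X (i + s)" d s] d(2)[of "i + _"] by (simp add: add.assoc)
      also have "\<dots> = X (s mod d)" using that d(1) by simp
      also have "\<dots> = X s" using mod_period[of X d s] d(2) by simp
      finally show ?thesis .
    qed
    then show ?thesis using True by (auto simp: occurrences_prefix_iff min_def)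
  qed (simp add: min_def)
  then have "derived_sequence X (X [0 \<rightarrow> n]) \<in> (\<lambda>n. derived_sequence X (X [0 \<rightarrow> n])) ` {..d}" for n
    by (intro image_eqI[of _ _ "min n d"] derived_sequence_cong) auto
  then have "{derived_sequence X u | u. u \<in> nonempty_prefixes X}
      \<subseteq> (\<lambda>n. derived_sequence X (X [0 \<rightarrow> n])) ` {..d}"
    unfolding nonempty_prefixes_def by blast
  then show ?thesis by (rule finite_subset) simp
qed

text \<open>
  In the application \<open>P n\<close> is the pair of letters number \<open>n\<close> and \<open>n + 1\<close> of the fixed point, and
  \<open>q n\<close> is the number of occurrences of the prefix that start before the image of letter \<open>n\<close>.
\<close>

definition block_coded :: "(nat \<Rightarrow> 'p) \<Rightarrow> nat \<Rightarrow> (nat \<Rightarrow> nat) \<Rightarrow> (nat \<Rightarrow> nat) \<Rightarrow> bool" where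
  "block_coded P M D q \<longleftrightarrow> q 0 = 0 \<and> strict_mono q \<and> (\<forall>n. q (Suc n) \<le> q n + M) \<and> (\<forall>i. D i \<le> M) \<and>
     (\<forall>m n. P m = P n \<longrightarrow> D [q m \<rightarrow> q (Suc m)] = (D [q n \<rightarrow> q (Suc n)]))"

text \<open>\<open>D\<close> is recovered from the table that sends each value of \<open>P\<close>
  to its coded word. The words have bounded length over a finite alphabet, so there are finitely
  many tables.\<close>

lemma finite_block_coded:
  fixes P :: "nat \<Rightarrow> 'p"
  assumes "finite (range P)"
  shows "finite {D. \<exists>q. block_coded P M D q}"
proof -
  define \<Q> where "\<Q> = {D. \<exists>q. block_coded P M D q}"
  have "\<forall>D\<in>\<Q>. \<exists>q. block_coded P M D q" unfolding \<Q>_def by blast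
  then obtain q where q: "\<And>D. D \<in> \<Q> \<Longrightarrow> block_coded P M D (q D)" by metis
  have q_0: "q D 0 = 0" and q_mono: "strict_mono (q D)" and q_le: "q D (Suc n) \<le> q D n + M"
    and D_le: "D i \<le> M"
    and q_eq: "P m = P n \<Longrightarrow> D [q D m \<rightarrow> q D (Suc m)] = D [q D n \<rightarrow> q D (Suc n)]"
    if "D \<in> \<Q>" for D m n i
    using q[OF that] unfolding block_coded_def by blast+
  have q_step: "q D n < q D (Suc n)" if "D \<in> \<Q>" for D n
    using q_mono[OF that] by (simp add: strict_mono_less)
  \<comment> \<open>The default \<open>[]\<close> outside the range of \<open>P\<close> keeps the
    set of tables finite.\<close>
  define \<Gamma> where "\<Gamma> D z = (if z \<in> range P then D [q D (inv P z) \<rightarrow> q D (Suc (inv P z))] else [])" for D z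
  have \<Gamma>: "\<Gamma> D (P n) = D [q D n \<rightarrow> q D (Suc n)]" if "D \<in> \<Q>" for D n
    unfolding \<Gamma>_def using q_eq[OF that, of "inv P (P n)" n] by (simp add: f_inv_into_f)
  let ?W = "{w. set w \<subseteq> {..M} \<and> length w \<le> M}"
  have "\<Gamma> D (P n) \<in> ?W" if "D \<in> \<Q>" for D n
    using q_le[OF that, of n] D_le[OF that] by (auto simp: \<Gamma>[OF that])
  then have "\<Gamma> D z \<in> ?W" if "D \<in> \<Q>" "z \<in> range P" for D z using that by blast
  moreover have "\<Gamma> D z = []" if "z \<notin> range P" for D z using that by (simp add: \<Gamma>_def)
  ultimately have "\<Gamma> ` \<Q> \<subseteq> {f. \<forall>z. (z \<in> range P \<longrightarrow> f z \<in> ?W) \<and> (z \<notin> range P \<longrightarrow> f z = [])}"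
    by blast
  moreover have "finite \<dots>"
    using assms finite_lists_length_le[of "{..M}" M] by (intro finite_set_of_finite_funs) auto
  ultimately have "finite (\<Gamma> ` \<Q>)" by (rule finite_subset)
  moreover have "inj_on \<Gamma> \<Q>"
  proof (rule inj_onI)
    fix D E assume DE: "D \<in> \<Q>" "E \<in> \<Q>" "\<Gamma> D = \<Gamma> E"
    then have eq: "D [q D n \<rightarrow> q D (Suc n)] = (E [q E n \<rightarrow> q E (Suc n)])" for n using \<Gamma> by metis
    \<comment> \<open>The lengths of the coded words rebuild the cut points from
      \<open>q D 0 = 0\<close>.\<close>
    have qq: "q D n = q E n" for n
    proof (induction n)
      case 0
      then show ?case using q_0 DE(1,2) by simp
    next
      case (Suc n)
      then show ?case
        using arg_cong[OF eq, of length n] q_step[OF DE(1), of n] q_step[OF DE(2), of n] by simp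
    qed
    show "D = E"
    proof
      fix i
      obtain n where n: "q D n \<le> i" "i < q D (Suc n)"
        using strict_mono_block[OF q_mono q_0] DE(1) by blast
      then show "D i = E i"
        using arg_cong[OF eq[of n], of "\<lambda>w. w ! (i - q D n)"] by (simp flip: qq)
    qed
  qed
  ultimately show ?thesis unfolding \<Q>_def by (rule finite_imageD)
qed

section \<open>Iterates of a substitution and their lengths\<close>

lemma extend_word_comp:
  "extend_word \<zeta> (extend_word \<xi> w) = extend_word (\<lambda>\<beta>. extend_word \<zeta> (\<xi> \<beta>)) w"
  by (induction w) (auto simp: extend_word_def)

lemma extend_word_iterate: "extend_word (iterate \<zeta> n) w = (extend_word \<zeta> ^^ n) w"
proof (induction n)
  case 0
  show ?case by (induction w) (auto simp: extend_word_def iterate_0)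
next
  case (Suc n)
  then show ?case by (simp add: iterate_Suc flip: extend_word_comp)
qed

lemma iterate_add: "iterate \<zeta> (m + n) \<beta> = extend_word (iterate \<zeta> m) (iterate \<zeta> n \<beta>)"
  by (simp add: extend_word_iterate) (simp add: iterate_def funpow_add)

lemma length_extend_word_le:
  "(\<And>\<beta>. \<beta> \<in> set w \<Longrightarrow> length (\<zeta> \<beta>) \<le> S) \<Longrightarrow> length (extend_word \<zeta> w) \<le> S * length w"
  by (induction w) (auto simp: extend_word_def add_mono)

lemma length_le_extend_word:
  "\<beta> \<in> set w \<Longrightarrow> length (\<zeta> \<beta>) \<le> length (extend_word \<zeta> w)"
  by (induction w) (auto simp: extend_word_def)

text \<open>\<open>p\<close> is a power that witnesses primitivity and \<open>S\<close> bounds the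
  lengths of the images. All later constants are built without reference to the prefix
  considered.\<close>

locale primitive_coding =
  fixes \<zeta> :: "'b \<Rightarrow> 'b list" and B :: "'b set" and \<alpha> :: 'b and \<phi> :: "'b \<Rightarrow> 'a" and S p :: nat
  assumes substitution: "substitution \<zeta> B \<alpha>"
    and primitive: "\<beta> \<in> B \<Longrightarrow> \<gamma> \<in> B \<Longrightarrow> \<gamma> \<in> set (iterate \<zeta> p \<beta>)"
    and length_image: "\<beta> \<in> B \<Longrightarrow> length (\<zeta> \<beta>) \<le> S"
begin

abbreviation Y :: "nat \<Rightarrow> 'b" where
  "Y \<equiv> fixed_point \<zeta> \<alpha>"

definition X :: "nat \<Rightarrow> 'a" where
  "X = \<phi> \<circ> Y"

abbreviation len :: "'b \<Rightarrow> nat \<Rightarrow> nat" where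
  "len \<beta> k \<equiv> length (iterate \<zeta> k \<beta>)"

lemma finite_B: "finite B" and \<alpha>_B: "\<alpha> \<in> B" and image_ne: "\<beta> \<in> B \<Longrightarrow> \<zeta> \<beta> \<noteq> []"
  using substitution unfolding substitution_def by blast+

lemma Y_B: "Y i \<in> B"
proof -
  obtain n where "Suc i \<le> len \<alpha> n" using long_iterate[OF substitution] by blast
  then show ?thesis
    using fixed_point_nth[OF substitution, of i n] set_iterate[OF substitution \<alpha>_B, of n] nth_mem[of i]
    by auto
qed

lemma len_add_le:
  assumes "\<beta> \<in> B"
  shows "len \<beta> (m + n) \<le> S ^ m * len \<beta> n"
proof (induction m)
  case (Suc m)
  have "len \<beta> (Suc m + n) \<le> S * len \<beta> (m + n)"
    unfolding add_Suc iterate_Suc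
    using length_image set_iterate[OF substitution assms] by (intro length_extend_word_le) blast
  also have "\<dots> \<le> S * (S ^ m * len \<beta> n)" using Suc by (rule mult_le_mono2)
  finally show ?case by (simp add: mult.assoc)
qed simp

text \<open>The letter \<gamma> appears in \<open>iterate \<zeta> p \<beta>\<close>, so its image
  under \<open>k\<close> further steps is part of that of \<beta>.\<close>

lemma len_le_len_add:
  assumes "\<beta> \<in> B" "\<gamma> \<in> B"
  shows "len \<gamma> k \<le> len \<beta> (k + p)"
  unfolding iterate_add by (rule length_le_extend_word[OF primitive[OF assms]])

lemma len_pos:
  assumes "\<beta> \<in> B"
  shows "0 < len \<beta> k"
proof (induction k)
  case (Suc k)
  then obtain \<gamma> where \<gamma>: "\<gamma> \<in> set (iterate \<zeta> k \<beta>)" using nth_mem by blast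
  then have "\<zeta> \<gamma> \<noteq> []" using set_iterate[OF substitution assms] image_ne by blast
  then show ?case using length_le_extend_word[OF \<gamma>, of \<zeta>] by (auto simp: iterate_Suc)
qed (simp add: iterate_0)

lemma S_pos: "0 < S"
  using length_image[OF \<alpha>_B] image_ne[OF \<alpha>_B] by (cases S) auto

text \<open>At the least level where all letters reach length \<open>l\<close>, the level before has
  a letter still below \<open>l\<close>. Primitivity compares the others with it at the cost
  \<open>S ^ p\<close>, and the last step costs a factor \<open>S\<close>.\<close>

lemma comparable_level:
  assumes "0 < l"
  obtains k where "\<And>\<beta>. \<beta> \<in> B \<Longrightarrow> l \<le> len \<beta> k" "\<And>\<beta>. \<beta> \<in> B \<Longrightarrow> len \<beta> k \<le> S ^ Suc p * l"
proof -
  define k where "k = (LEAST k. \<forall>\<beta>\<in>B. l \<le> len \<beta> k)"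
  obtain n where "l \<le> len \<alpha> n" using long_iterate[OF substitution] by blast
  then have "\<forall>\<beta>\<in>B. l \<le> len \<beta> (n + p)" using len_le_len_add[OF _ \<alpha>_B] order_trans by blast
  then have low: "\<forall>\<beta>\<in>B. l \<le> len \<beta> k" unfolding k_def by (rule LeastI)
  have up: "len \<beta> k \<le> S ^ Suc p * l" if \<beta>: "\<beta> \<in> B" for \<beta>
  proof (cases k)
    case 0
    then show ?thesis using S_pos assms by (simp add: iterate_0 Suc_le_eq)
  next
    case (Suc k')
    then have "\<not> (\<forall>\<beta>\<in>B. l \<le> len \<beta> k')"
      using not_less_Least[of k' "\<lambda>k. \<forall>\<beta>\<in>B. l \<le> len \<beta> k"] unfolding k_def by simp
    then obtain \<gamma> where \<gamma>: "\<gamma> \<in> B" "len \<gamma> k' < l" by (auto simp: not_le)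
    have "len \<beta> k \<le> S * len \<beta> k'" using len_add_le[OF \<beta>, of 1 k'] Suc by simp
    also have "len \<beta> k' \<le> S ^ p * len \<gamma> k'"
      using len_le_len_add[OF \<gamma>(1) \<beta>, of k'] len_add_le[OF \<gamma>(1), of p k'] by (simp add: add.commute)
    also have "S ^ p * len \<gamma> k' \<le> S ^ p * l" using \<gamma>(2) by simp
    finally show ?thesis by (simp add: mult.assoc)
  qed
  show ?thesis by (rule that[of k]) (use low up in auto)
qed

text \<open>The position in \<open>Y\<close> of the block \<open>iterate \<zeta> m (Y n)\<close>; as
  \<open>Y\<close> is a fixed point, these blocks cut up \<open>Y\<close> itself.\<close>

definition start :: "nat \<Rightarrow> nat \<Rightarrow> nat" where
  "start m n = length (extend_word (iterate \<zeta> m) (Y [0 \<rightarrow> n]))"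

lemma extend_iterate_prefix: "extend_word (iterate \<zeta> m) (Y [0 \<rightarrow> n]) = Y [0 \<rightarrow> start m n]"
proof (induction m)
  case 0
  then show ?case by (simp add: start_def extend_word_iterate)
next
  case (Suc m)
  have "extend_word (iterate \<zeta> (Suc m)) (Y [0 \<rightarrow> n]) = extend_word \<zeta> (Y [0 \<rightarrow> start m n])"
    using Suc by (simp add: extend_word_iterate)
  then show ?case
    using fixed_point_fixed(2)[OF substitution, of "start m n"] unfolding start_def by simp
qed

lemma prefix_start_Suc: "Y [0 \<rightarrow> start m (Suc n)] = Y [0 \<rightarrow> start m n] @ iterate \<zeta> m (Y n)"
  using subsequence_split[of 0 n "Suc n" Y]
  by (simp add: extend_word_append flip: extend_iterate_prefix) (simp add: extend_word_def)

lemma start_0: "start m 0 = 0"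
  by (simp add: start_def extend_word_def)

lemma start_Suc: "start m (Suc n) = start m n + len (Y n) m"
  using arg_cong[OF prefix_start_Suc, of length] by simp

lemma strict_mono_start: "strict_mono (start m)"
  unfolding strict_mono_Suc_iff start_Suc using len_pos[OF Y_B] by simp

lemma Y_start:
  assumes "s < len (Y n) m"
  shows "Y (start m n + s) = iterate \<zeta> m (Y n) ! s"
  using arg_cong[OF prefix_start_Suc[of m n], of "\<lambda>w. w ! (start m n + s)"] assms
  by (simp add: start_Suc nth_append)

text \<open>Two blocks are compared because a word that starts in one block may reach into the
  next.\<close>

lemma X_two_blocks:
  assumes "Y i = Y j" "Y (Suc i) = Y (Suc j)" "start m i + s < start m (Suc (Suc i))"
  shows "X (start m i + s) = X (start m j + s)"
proof (cases "s < len (Y i) m")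
  case True
  then show ?thesis using Y_start[of s m i] Y_start[of s m j] assms(1) by (simp add: X_def)
next
  case False
  then obtain s' where s': "s = len (Y i) m + s'" by (metis le_Suc_ex not_less)
  then have "s' < len (Y (Suc i)) m" using assms(3) by (simp add: start_Suc)
  then have "Y (start m (Suc i) + s') = Y (start m (Suc j) + s')"
    using Y_start[of s' m "Suc i"] Y_start[of s' m "Suc j"] assms(2) by simp
  then show ?thesis using s' assms(1) by (simp add: X_def start_Suc add.assoc)
qed

section \<open>Pairs of consecutive letters and the blocks they determine\<close>

abbreviation pair :: "nat \<Rightarrow> 'b \<times> 'b" where
  "pair n \<equiv> (Y n, Y (Suc n))"

lemma finite_pairs: "finite (range pair)"
  by (rule finite_subset[of _ "B \<times> B"]) (use Y_B finite_B in auto)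

text \<open>Used to bound the number of occurrences of a prefix in a block of comparable
  length.\<close>

lemma occurrences_distance:
  assumes "\<not> periodic X"
  obtains K where "\<And>n x y. x \<in> occurrences X (X [0 \<rightarrow> n]) \<Longrightarrow> y \<in> occurrences X (X [0 \<rightarrow> n]) \<Longrightarrow>
    x < y \<Longrightarrow> n < K * (y - x)"
proof -
  obtain N where N: "\<And>n. \<exists>m<N. pair m = pair n" using finite_range_bounded[OF finite_pairs] by metis
  define C where "C = S ^ Suc p"
  \<comment> \<open>All pairs appear within the first \<open>Suc N\<close> blocks, each of length at
    most \<open>C * Suc d\<close>, and \<open>Suc d\<close> is at most \<open>2 * d\<close>.\<close>
  define K where "K = Suc N * C * 2"
  \<comment> \<open>If the bound failed, the prefix of length \<open>n\<close> would have period \<open>d\<close> and contain all factors of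
    length \<open>d + 1\<close>, so that all of \<open>X\<close> would have period \<open>d\<close>.\<close>
  have "n < K * d" if x: "x \<in> occurrences X (X [0 \<rightarrow> n])"
    and y: "x + d \<in> occurrences X (X [0 \<rightarrow> n])" and d: "0 < d" for n x d
  proof (rule ccontr)
    assume "\<not> n < K * d"
    obtain k where low: "\<And>\<beta>. \<beta> \<in> B \<Longrightarrow> Suc d \<le> len \<beta> k"
      and up: "\<And>\<beta>. \<beta> \<in> B \<Longrightarrow> len \<beta> k \<le> C * Suc d"
      using comparable_level[of "Suc d"] unfolding C_def by blast
    have "start k m \<le> m * (C * Suc d)" for m
    proof (induction m)
      case (Suc m)
      then show ?case unfolding start_Suc mult_Suc using up[OF Y_B, of m] by linarith
    qed (simp add: start_0)
    from this[of "Suc N"] have "start k (Suc N) \<le> Suc N * C * Suc d" by (simp only: mult.assoc)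
    also have "\<dots> \<le> Suc N * C * (2 * d)" using d by (intro mult_le_mono2) simp
    also have "\<dots> \<le> n" using \<open>\<not> n < K * d\<close> unfolding K_def by (simp only: mult.assoc not_less)
    finally have le: "start k (Suc N) \<le> n" .
    have "X (t + d) = X t" for t
    proof -
      obtain i where i: "start k i \<le> t" "t < start k (Suc i)"
        using strict_mono_block[OF strict_mono_start start_0] by metis
      obtain j where j: "j < N" "pair j = pair i" using N by blast
      define s where "s = t - start k i"
      have t: "t = start k i + s" using i(1) by (simp add: s_def)
      have s: "start k i + (s + d) < start k (Suc (Suc i))"
        using i(2) low[OF Y_B, of "Suc i"] t by (simp add: start_Suc)
      have s': "start k j + (s + d) < start k (Suc (Suc j))" using s j(2) by (simp add: start_Suc)
      also have "\<dots> \<le> start k (Suc N)" using strict_mono_start j(1) by (simp add: strict_mono_less_eq)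
      finally have "start k j + s + d < n" using le by simp
      from occurrences_period[OF x y this]
      have "X (start k j + (s + d)) = X (start k j + s)" by (simp add: add.assoc)
      then show ?thesis
        using X_two_blocks[of i j k s] X_two_blocks[of i j k "s + d"] s j(2) t
        by (simp add: add.assoc)
    qed
    then show False using assms d unfolding periodic_def by blast
  qed
  then show ?thesis using that[of K] by (metis le_add_diff_inverse less_imp_le zero_less_diff)
qed

lemma block_coded_derived:
  assumes np: "\<not> periodic X"
  obtains M where "\<And>l. 0 < l \<Longrightarrow> \<exists>q. block_coded pair M (derived_sequence X (X [0 \<rightarrow> l])) q"
proof -
  obtain K where K: "\<And>n x y. x \<in> occurrences X (X [0 \<rightarrow> n]) \<Longrightarrow> y \<in> occurrences X (X [0 \<rightarrow> n]) \<Longrightarrow>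
    x < y \<Longrightarrow> n < K * (y - x)" using occurrences_distance[OF np] by metis
  obtain N where N: "\<And>n. \<exists>m<N. pair m = pair n" using finite_range_bounded[OF finite_pairs] by metis
  \<comment> \<open>\<open>S ^ Suc p\<close> comes from \<open>comparable_level\<close>, and
    \<open>S ^ p\<close> from the passage to level \<open>k + p\<close>.\<close>
  define C where "C = S ^ p * S ^ Suc p"
  define M where "M = Suc (K * C)"
  have "0 < N" using N[of 0] by auto
  then have M_le: "M \<le> N * M" by simp
  have "\<exists>q. block_coded pair (N * M) (derived_sequence X (X [0 \<rightarrow> l])) q" if l: "0 < l" for l
  proof -
    obtain k where low: "\<And>\<beta>. \<beta> \<in> B \<Longrightarrow> l \<le> len \<beta> k"
      and up: "\<And>\<beta>. \<beta> \<in> B \<Longrightarrow> len \<beta> k \<le> S ^ Suc p * l"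
      using comparable_level[OF l] by blast
    define T where "T = occurrences X (X [0 \<rightarrow> l])"
    \<comment> \<open>At level \<open>k + p\<close> every block contains
      \<open>iterate \<zeta> k \<alpha>\<close>, whose coding begins with the prefix of length
      \<open>l\<close>.\<close>
    define L where "L = start (k + p)"
    define q where "q n = rank T (L n)" for n
    have L_Suc: "L (Suc n) = L n + len (Y n) (k + p)" for n unfolding L_def by (rule start_Suc)
    have L_mono: "strict_mono L" unfolding L_def by (rule strict_mono_start)
    have L_low: "L n + l \<le> L (Suc n)" for n
      using low[OF \<alpha>_B] len_le_len_add[OF Y_B \<alpha>_B, of k n] by (simp add: L_Suc)
    have L_up: "L (Suc n) \<le> L n + C * l" for n
    proof -
      have "len (Y n) (k + p) \<le> S ^ p * len (Y n) k"
        using len_add_le[OF Y_B, of p k n] by (simp add: add.commute)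
      also have "\<dots> \<le> S ^ p * (S ^ Suc p * l)" using up[OF Y_B] by (rule mult_le_mono2)
      finally show ?thesis by (simp add: L_Suc C_def mult.assoc)
    qed
    have occ: "\<exists>i\<in>T. L n \<le> i \<and> i + l \<le> L (Suc n)" for n
    proof -
      obtain v w where vw: "iterate \<zeta> p (Y n) = v @ \<alpha> # w"
        using primitive[OF Y_B \<alpha>_B] by (meson split_list)
      let ?v = "extend_word (iterate \<zeta> k) v" and ?w = "extend_word (iterate \<zeta> k) w"
      have it: "iterate \<zeta> (k + p) (Y n) = ?v @ iterate \<zeta> k \<alpha> @ ?w"
        unfolding iterate_add vw by (simp add: extend_word_def)
      have "X (L n + length ?v + s) = X s" if "s < l" for s
      proof -
        have s: "s < len \<alpha> k" using that low[OF \<alpha>_B] by simp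
        have "Y (L n + (length ?v + s)) = iterate \<zeta> (k + p) (Y n) ! (length ?v + s)"
          unfolding L_def by (rule Y_start) (use s in \<open>simp add: it\<close>)
        also have "\<dots> = iterate \<zeta> k \<alpha> ! s" using s by (simp add: it nth_append)
        also have "\<dots> = Y s" using fixed_point_nth[OF substitution s] by simp
        finally show ?thesis by (simp add: X_def add.assoc)
      qed
      then have "L n + length ?v \<in> T" unfolding T_def occurrences_prefix_iff by blast
      moreover have "L n + length ?v + l \<le> L (Suc n)" using low[OF \<alpha>_B] by (simp add: L_Suc it)
      ultimately show ?thesis by (intro bexI[of _ "L n + length ?v"]) simp
    qed
    have inf: "infinite T"
      unfolding infinite_nat_iff_unbounded_le
      using occ strict_mono_imp_increasing[OF L_mono] order_trans by meson
    interpret infinitely_occurring X "X [0 \<rightarrow> l]" by unfold_locales (use inf in \<open>simp add: T_def\<close>)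
    have q_0: "q 0 = 0" by (simp add: q_def L_def start_0 rank_0)
    have q_step: "q n < q (Suc n)" for n
    proof -
      obtain i where "i \<in> T" "L n \<le> i" "i + l \<le> L (Suc n)" using occ by blast
      then have "rank T (L n) \<le> rank T i" "rank T (Suc i) \<le> rank T (L (Suc n))"
        using l by (auto intro!: rank_mono)
      moreover have "rank T (Suc i) = Suc (rank T i)" using \<open>i \<in> T\<close> by (simp add: rank_Suc)
      ultimately show ?thesis unfolding q_def by simp
    qed
    then have q_mono: "strict_mono q" by (simp add: strict_mono_Suc_iff)
    have q_le: "q (Suc n) \<le> q n + M" for n
    proof -
      \<comment> \<open>Occurrences are more than \<open>l / K\<close> apart, so \<open>?f\<close>
        separates them; its values stay at most \<open>K * C\<close> because a block has length at
        most \<open>C * l\<close>.\<close>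
      let ?I = "T \<inter> {L n..<L (Suc n)}" and ?f = "\<lambda>i. K * (i - L n) div l"
      have "T \<inter> {..<L (Suc n)} = (T \<inter> {..<L n}) \<union> ?I" using L_low[of n] by auto
      then have "q (Suc n) \<le> q n + card ?I" unfolding q_def rank_def by (simp add: card_Un_le)
      moreover have "card ?I \<le> card {..K * C}"
      proof (rule card_inj_on_le)
        have "?f x < ?f y" if "x \<in> ?I" "y \<in> ?I" "x < y" for x y
        proof -
          have "l + K * (x - L n) \<le> K * (y - x) + K * (x - L n)"
            using K[of x l y] that unfolding T_def by simp
          also have "\<dots> = K * (y - L n)" using that by (simp flip: add_mult_distrib2)
          finally have "(l + K * (x - L n)) div l \<le> ?f y" by (rule div_le_mono)
          then show ?thesis using l by simp
        qed
        then show "inj_on ?f ?I" by (intro linorder_inj_onI') (use less_imp_neq in blast)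
        have "?f x \<le> K * C" if "x \<in> ?I" for x
        proof -
          have "x - L n \<le> C * l" using that L_up[of n] by auto
          then have "K * (x - L n) \<le> K * C * l" unfolding mult.assoc by (rule mult_le_mono2)
          then have "?f x \<le> (K * C * l) div l" by (rule div_le_mono)
          then show ?thesis using l by simp
        qed
        then show "?f ` ?I \<subseteq> {..K * C}" by blast
      qed simp
      ultimately show ?thesis unfolding M_def by simp
    qed
    have code: "q (Suc i) + q j = q (Suc j) + q i"
      "r < q (Suc i) - q i \<Longrightarrow>
        return_factor X (X [0 \<rightarrow> l]) (q i + r) = return_factor X (X [0 \<rightarrow> l]) (q j + r)"
      if eq: "pair i = pair j" for i j r
    proof -
      \<comment> \<open>An occurrence at an offset of at most \<open>?h\<close> ends within the two
        blocks that the pair determines.\<close>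
      let ?h = "L (Suc (Suc i)) - l - L i"
      have h: "L (Suc i) \<le> L i + ?h" "L i + (?h + l) = L (Suc (Suc i))"
        using L_low[of i] L_low[of "Suc i"] by linarith+
      have w: "X (L i + s) = X (L j + s)" if "s < ?h + l" for s
        using X_two_blocks[of i j "k + p" s] eq that h(2) unfolding L_def by simp
      note win = inf[unfolded T_def] w
      have "L (Suc i) = L i + len (Y i) (k + p)" "L (Suc j) = L j + len (Y i) (k + p)"
        using eq by (simp_all add: L_Suc)
      then show "q (Suc i) + q j = q (Suc j) + q i"
        using window_rank[OF win, where h = ?h and s = "len (Y i) (k + p)"] h(1)
        unfolding q_def T_def by simp
      assume r: "r < q (Suc i) - q i"
      \<comment> \<open>An occurrence in the second block ensures that every return word starting in
        the first block ends inside the window.\<close>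
      obtain x where x: "x \<in> T" "L (Suc i) \<le> x" "x + l \<le> L (Suc (Suc i))" using occ by blast
      have "q i + Suc r \<le> rank T x"
        using r rank_mono[OF x(2), of T] unfolding q_def by simp
      then have "enumerate T (q i + Suc r) \<le> enumerate T (rank T x)" using inf by simp
      also have "\<dots> = x" by (rule enumerate_rank[OF inf x(1)])
      also have "\<dots> \<le> L i + ?h" using x(3) h(2) by linarith
      finally have "enumerate (occurrences X (X [0 \<rightarrow> l]))
        (rank (occurrences X (X [0 \<rightarrow> l])) (L i) + Suc r) \<le> L i + ?h" by (simp only: q_def T_def)
      from window_return_factor[OF win, where h = ?h, OF _ this]
      show "return_factor X (X [0 \<rightarrow> l]) (q i + r) = return_factor X (X [0 \<rightarrow> l]) (q j + r)"
        by (simp add: q_def T_def)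
    qed
    \<comment> \<open>Every pair is represented below \<open>N\<close> and at most \<open>M\<close>
      return words start in each block, which gives \<open>N * M\<close> as a bound for the letters
      of the derived sequence.\<close>
    let ?F = "(\<lambda>(n, r). return_factor X (X [0 \<rightarrow> l]) (q n + r)) ` ({..<N} \<times> {..<M})"
    have "return_words X (X [0 \<rightarrow> l]) \<subseteq> ?F"
      unfolding return_words_eq
    proof clarify
      fix t
      obtain n where n: "q n \<le> t" "t < q (Suc n)" using strict_mono_block[OF q_mono q_0] by metis
      obtain m where m: "m < N" "pair m = pair n" using N by blast
      have "return_factor X (X [0 \<rightarrow> l]) t = return_factor X (X [0 \<rightarrow> l]) (q m + (t - q n))"
        using code(2)[OF m(2)[symmetric], of "t - q n"] n by simp
      moreover have "t - q n < M" using n q_le[of n] by linarith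
      ultimately show "return_factor X (X [0 \<rightarrow> l]) t \<in> ?F"
        using m(1) by (auto intro!: image_eqI[of _ _ "(m, t - q n)"])
    qed
    moreover have F: "finite ?F" by simp
    ultimately have fin: "finite (return_words X (X [0 \<rightarrow> l]))"
      and "card (return_words X (X [0 \<rightarrow> l])) \<le> card ?F"
      using finite_subset card_mono by blast+
    moreover have "card ?F \<le> N * M" by (rule order_trans[OF card_image_le]) auto
    ultimately have le: "derived_sequence X (X [0 \<rightarrow> l]) i \<le> N * M" for i
      using derived_sequence_le[OF fin, of i] by linarith
    let ?D = "derived_sequence X (X [0 \<rightarrow> l])"
    have "?D [q i \<rightarrow> q (Suc i)] = (?D [q j \<rightarrow> q (Suc j)])" if "pair i = pair j" for i j
    proof -
      have "q (Suc i) - q i = q (Suc j) - q j"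
        using code(1)[OF that] q_step[of i] q_step[of j] by linarith
      moreover have "?D (q i + r) = ?D (q j + r)" if "r < q (Suc i) - q i" for r
        unfolding derived_sequence_eq_iff[OF fin] by (rule code(2)[OF \<open>pair i = pair j\<close> that])
      ultimately show ?thesis
        using q_step[of i] q_step[of j] by (intro subsequence_eqI) simp_all
    qed
    moreover have "q (Suc n) \<le> q n + N * M" for n using q_le[of n] M_le by linarith
    ultimately show ?thesis using q_0 q_mono le unfolding block_coded_def by blast
  qed
  then show ?thesis using that by blast
qed

lemma finite_derived: "finite {derived_sequence X u | u. u \<in> nonempty_prefixes X}"
proof (cases "periodic X")
  case False
  obtain M where M: "\<And>l. 0 < l \<Longrightarrow> \<exists>q. block_coded pair M (derived_sequence X (X [0 \<rightarrow> l])) q"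
    using block_coded_derived[OF False] by blast
  have "{derived_sequence X u | u. u \<in> nonempty_prefixes X} \<subseteq> {D. \<exists>q. block_coded pair M D q}"
    using M unfolding nonempty_prefixes_def by fastforce
  then show ?thesis using finite_block_coded[OF finite_pairs] finite_subset by blast
qed (rule periodic_finite_derived)

end

lemma substitutive_primitive_finite_derived:
  assumes "substitutive_primitive A X"
  shows "finite {derived_sequence X u | u. u \<in> nonempty_prefixes X}"
proof -
  obtain \<zeta> :: "nat \<Rightarrow> nat list" and B \<alpha> \<phi> where prim: "primitive_substitution \<zeta> B \<alpha>"
    and X: "X = \<phi> \<circ> fixed_point \<zeta> \<alpha>"
    using assms unfolding substitutive_primitive_def by blast
  then obtain p where sub: "substitution \<zeta> B \<alpha>"
    and p: "\<And>\<beta> \<gamma>. \<beta> \<in> B \<Longrightarrow> \<gamma> \<in> B \<Longrightarrow> \<gamma> \<in> set (iterate \<zeta> p \<beta>)"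
    unfolding primitive_substitution_def by blast
  from sub have "finite ((\<lambda>\<beta>. length (\<zeta> \<beta>)) ` B)" unfolding substitution_def by simp
  then obtain S where S: "\<And>\<beta>. \<beta> \<in> B \<Longrightarrow> length (\<zeta> \<beta>) \<le> S"
    unfolding finite_nat_set_iff_bounded_le by blast
  interpret primitive_coding \<zeta> B \<alpha> \<phi> S p using sub p S by unfold_locales
  show ?thesis using finite_derived unfolding X_def X .
qed

subsection \<open>The characterization\<close>

theorem theorem5:
  fixes A :: "'a set" and X :: "nat \<Rightarrow> 'a"
  assumes "finite A" and "range X \<subseteq> A" and "minimal_sequence X"
  shows "substitutive_primitive A X \<longleftrightarrow>
    finite {derived_sequence X u | u. u \<in> nonempty_prefixes X}"
  using assms substitutive_primitive_finite_derived finite_derived_substitutive_primitive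
    periodic_substitutive_primitive by blast

end
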